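(* The functor $\mathsf{M}\colon\mathbf{ResRel}_{\otimes}\to\mathbf{Quant}$, sending a residuated relation $R$ to its concept quantale $\mathsf{M}R$ and a multiplicative bond $\mathbf{b}\colon R\to S$ to the induced map $\mathbf{b}_*\colon\mathsf{M}R\to\mathsf{M}S$, is an equivalence of categories.
   Context: $\mathbf{Quant}$ is the category of quantales (complete lattices with an associative multiplication preserving arbitrary suprema in each variable; no unit assumed) and maps preserving arbitrary suprema and multiplication. For a relation $R\subseteq X\times Y$ (write $xRy$ for $(x,y)\in R$), $A\subseteq X$ and $B\subseteq Y$, put $R^{\uparrow}(A)=\{y\in Y\mid \forall a\in A,\ aRy\}$ and $R^{\downarrow}(B)=\{x\in X\mid \forall b\in B,\ xRb\}$. An $R$-extent is a subset $A\subseteq X$ with $A=R^{\downarrow}R^{\uparrow}(A)$; an $R$-intent is a subset $B\subseteq Y$ with $B=R^{\uparrow}R^{\downarrow}(B)$. $\mathsf{M}R$ is the complete lattice of $R$-extents ordered by inclusion. For a semigroup $X$ and a set $Y$, a relation $R\subseteq X\times Y$ is residuated if there exist maps $\swarrow\colon Y\times X\to Y$ and $\searrow\colon X\times Y\to Y$ such that $(xx')Ry\iff xR(y\swarrow x')\iff x'R(x\searrow y)$ for all $x,x'\in X$, $y\in Y$. For a residuated relation $R$, $\mathsf{M}R$ is a quantale with multiplication $A\otimes_R B=R^{\downarrow}R^{\uparrow}(A*B)$, where $A*B=\{ab\mid a\in A,\ b\in B\}$, and suprema $\bigsqcup_i A_i=R^{\downarrow}R^{\uparrow}(\bigcup_i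 A_i)$. For $S$-intents $P,Q$ of a residuated relation $S$, put $P\otimes_S Q=S^{\uparrow}(S^{\downarrow}(P)*S^{\downarrow}(Q))$. A bond from $R\subseteq X\times Y$ to $S\subseteq Z\times W$ is a relation $\mathbf{b}\subseteq X\times W$ such that every row $\mathbf{b}[x]=\{w\in W\mid x\mathbf{b}w\}$ is an $S$-intent and every column $\mathbf{b}^{-1}[w]=\{x\in X\mid x\mathbf{b}w\}$ is an $R$-extent. It induces $\mathbf{b}_*\colon\mathsf{M}R\to\mathsf{M}S$, $\mathbf{b}_*(A)=S^{\downarrow}\mathbf{b}^{\uparrow}(A)$, where $\mathbf{b}^{\uparrow}(A)=\{w\in W\mid\forall a\in A,\ a\mathbf{b}w\}$. A bond between residuated relations is multiplicative if $\mathbf{b}[xx']=\mathbf{b}[x]\otimes_S\mathbf{b}[x']$ for all $x,x'\in X$. The identity bond on $R$ is $R$ itself. The composite of bonds $\mathbf{b}\colon R\to S$ and $\mathbf{c}\colon S\to T$, with $T\subseteq U\times V$, is the bond $\mathbf{c}\circ\mathbf{b}\subseteq X\times V$ given by $x(\mathbf{c}\circ\mathbf{b})v\iff S^{\downarrow}(\mathbf{b}[x])\subseteq\mathbf{c}^{-1}[v]$; equivalently, it is the unique bond $R\to T$ with $(\mathbf{c}\circ\mathbf{b})_*=\mathbf{c}_*\circ\mathbf{b}_*$. $\mathbf{ResRel}_{\otimes}$ is the category whose objects are residuated relations (a semigroup $X$, a set $Y$ and a residuated relation $R\subseteq X\times Y$), whose morphisms are multiplicative bonds, and whose identities and composition are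 those of bonds. *)

theory Defs
  imports "HOL-Algebra.Complete_Lattice" "HOL-Library.Equipollence" "HOL-Library.FuncSet"
begin

section \<open>Categories, functors, equivalences\<close>

text \<open>Arrows do not record their domain and codomain; composition, the arrow map of a
  functor and the hom-sets take the objects as explicit arguments instead:
  \<open>Comp C a b c g f\<close> is the composite of \<open>f : a \<rightarrow> b\<close> and \<open>g : b \<rightarrow> c\<close>.\<close>

record ('o, 'm) cat =
  Obj :: "'o set"
  Hom :: "'o \<Rightarrow> 'o \<Rightarrow> 'm set"
  Id :: "'o \<Rightarrow> 'm"
  Comp :: "'o \<Rightarrow> 'o \<Rightarrow> 'o \<Rightarrow> 'm \<Rightarrow> 'm \<Rightarrow> 'm"

locale category =
  fixes C :: "('o, 'm) cat"
  assumes Id_in_Hom: "a \<in> Obj C \<Longrightarrow> Id C a \<in> Hom C a a"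
    and Comp_in_Hom: "\<lbrakk>a \<in> Obj C; b \<in> Obj C; c \<in> Obj C; f \<in> Hom C a b; g \<in> Hom C b c\<rbrakk>
      \<Longrightarrow> Comp C a b c g f \<in> Hom C a c"
    and Comp_Id_right: "\<lbrakk>a \<in> Obj C; b \<in> Obj C; f \<in> Hom C a b\<rbrakk> \<Longrightarrow> Comp C a a b f (Id C a) = f"
    and Comp_Id_left: "\<lbrakk>a \<in> Obj C; b \<in> Obj C; f \<in> Hom C a b\<rbrakk> \<Longrightarrow> Comp C a b b (Id C b) f = f"
    and Comp_assoc: "\<lbrakk>a \<in> Obj C; b \<in> Obj C; c \<in> Obj C; d \<in> Obj C;
        f \<in> Hom C a b; g \<in> Hom C b c; h \<in> Hom C c d\<rbrakk>
      \<Longrightarrow> Comp C a c d h (Comp C a b c g f) = Comp C a b d (Comp C b c d h g) f"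

definition iso_arrow :: "('o, 'm) cat \<Rightarrow> 'o \<Rightarrow> 'o \<Rightarrow> 'm \<Rightarrow> bool" where
  "iso_arrow C a b f \<longleftrightarrow> f \<in> Hom C a b \<and>
    (\<exists>g \<in> Hom C b a. Comp C a b a g f = Id C a \<and> Comp C b a b f g = Id C b)"

record ('o, 'm, 'p, 'n) fun_data =
  obj_map :: "'o \<Rightarrow> 'p"
  arr_map :: "'o \<Rightarrow> 'o \<Rightarrow> 'm \<Rightarrow> 'n"

locale cat_functor = source: category C + target: category D
  for C :: "('o, 'm) cat" and D :: "('p, 'n) cat" +
  fixes F :: "('o, 'm, 'p, 'n) fun_data"
  assumes obj_map_in_Obj: "a \<in> Obj C \<Longrightarrow> obj_map F a \<in> Obj D"
    and arr_map_in_Hom: "\<lbrakk>a \<in> Obj C; b \<in> Obj C; f \<in> Hom C a b\<rbrakk>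
      \<Longrightarrow> arr_map F a b f \<in> Hom D (obj_map F a) (obj_map F b)"
    and arr_map_Id: "a \<in> Obj C \<Longrightarrow> arr_map F a a (Id C a) = Id D (obj_map F a)"
    and arr_map_Comp: "\<lbrakk>a \<in> Obj C; b \<in> Obj C; c \<in> Obj C; f \<in> Hom C a b; g \<in> Hom C b c\<rbrakk>
      \<Longrightarrow> arr_map F a c (Comp C a b c g f) =
        Comp D (obj_map F a) (obj_map F b) (obj_map F c) (arr_map F b c g) (arr_map F a b f)"

definition id_fun :: "('o, 'm, 'o, 'm) fun_data" where
  "id_fun = \<lparr>obj_map = (\<lambda>a. a), arr_map = (\<lambda>a b f. f)\<rparr>"

definition comp_fun ::
    "('p, 'n, 'q, 'k) fun_data \<Rightarrow> ('o, 'm, 'p, 'n) fun_data \<Rightarrow> ('o, 'm, 'q, 'k) fun_data" where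
  "comp_fun G F = \<lparr>obj_map = (\<lambda>a. obj_map G (obj_map F a)),
     arr_map = (\<lambda>a b f. arr_map G (obj_map F a) (obj_map F b) (arr_map F a b f))\<rparr>"

locale natural_iso = F: cat_functor C D F + G: cat_functor C D G
  for C :: "('o, 'm) cat" and D :: "('p, 'n) cat" and F G +
  fixes \<eta> :: "'o \<Rightarrow> 'n"
  assumes component_iso: "a \<in> Obj C \<Longrightarrow> iso_arrow D (obj_map F a) (obj_map G a) (\<eta> a)"
    and naturality: "\<lbrakk>a \<in> Obj C; b \<in> Obj C; f \<in> Hom C a b\<rbrakk> \<Longrightarrow>
        Comp D (obj_map F a) (obj_map F b) (obj_map G b) (\<eta> b) (arr_map F a b f) =
        Comp D (obj_map F a) (obj_map G a) (obj_map G b) (arr_map G a b f) (\<eta> a)"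

definition equivalence_of_categories ::
    "('o, 'm) cat \<Rightarrow> ('p, 'n) cat \<Rightarrow> ('o, 'm, 'p, 'n) fun_data \<Rightarrow> bool" where
  "equivalence_of_categories C D F \<longleftrightarrow> cat_functor C D F \<and>
    (\<exists>G \<eta> \<epsilon>. cat_functor D C G \<and>
      natural_iso C C id_fun (comp_fun G F) \<eta> \<and>
      natural_iso D D (comp_fun F G) id_fun \<epsilon>)"


section \<open>Size\<close>

text \<open>HOL has no type of all sets, so the categories below are formed relative to an
  arbitrary family \<open>\<U>\<close> of sets over a type, which plays the role of the universe; a set over
  any type is small if it is equipollent to a member of \<open>\<U>\<close>. Taking for \<open>\<U>\<close> all sets over
  a type bounds cardinalities by the cardinality of that type.\<close>

definition small :: "'u set set \<Rightarrow> 'a set \<Rightarrow> bool" where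
  "small \<U> A \<longleftrightarrow> (\<exists>B \<in> \<U>. A \<approx> B)"


section \<open>Quantales\<close>

record 'a quant = "'a gorder" +
  qtimes :: "'a \<Rightarrow> 'a \<Rightarrow> 'a" (infixl \<open>\<cdot>\<index>\<close> 70)

locale quantale = complete_lattice Q for Q :: "'a quant" (structure) +
  assumes qtimes_closed: "\<lbrakk>x \<in> carrier Q; y \<in> carrier Q\<rbrakk> \<Longrightarrow> x \<cdot> y \<in> carrier Q"
    and qtimes_assoc: "\<lbrakk>x \<in> carrier Q; y \<in> carrier Q; z \<in> carrier Q\<rbrakk>
      \<Longrightarrow> (x \<cdot> y) \<cdot> z = x \<cdot> (y \<cdot> z)"
    and qtimes_Sup_right: "\<lbrakk>x \<in> carrier Q; A \<subseteq> carrier Q\<rbrakk>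
      \<Longrightarrow> x \<cdot> (\<Squnion>A) = \<Squnion>((\<lambda>a. x \<cdot> a) ` A)"
    and qtimes_Sup_left: "\<lbrakk>x \<in> carrier Q; A \<subseteq> carrier Q\<rbrakk>
      \<Longrightarrow> (\<Squnion>A) \<cdot> x = \<Squnion>((\<lambda>a. a \<cdot> x) ` A)"

text \<open>Homomorphisms are extensional functions, so that equality of arrows is equality on
  the carrier.\<close>

definition quantale_hom :: "'a quant \<Rightarrow> 'b quant \<Rightarrow> ('a \<Rightarrow> 'b) set" where
  "quantale_hom P Q = {f \<in> carrier P \<rightarrow>\<^sub>E carrier Q.
    (\<forall>A \<subseteq> carrier P. f (\<Squnion>\<^bsub>P\<^esub>A) = \<Squnion>\<^bsub>Q\<^esub>(f ` A)) \<and>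
    (\<forall>x \<in> carrier P. \<forall>y \<in> carrier P. f (x \<cdot>\<^bsub>P\<^esub> y) = f x \<cdot>\<^bsub>Q\<^esub> f y)}"

definition Quant :: "'u set set \<Rightarrow> ('a quant, 'a \<Rightarrow> 'a) cat" where
  "Quant \<U> = \<lparr>
     Obj = {Q. quantale Q \<and> small \<U> (carrier Q)},
     Hom = quantale_hom,
     Id = (\<lambda>Q. \<lambda>x \<in> carrier Q. x),
     Comp = (\<lambda>P Q S g f. compose (carrier P) g f)\<rparr>"


section \<open>Residuated relations and their concept quantales\<close>

text \<open>A relation from the semigroup \<open>(lhs R, smult R)\<close> to the set \<open>rhs R\<close>.\<close>

record ('x, 'y) srel =
  lhs :: "'x set"
  smult :: "'x \<Rightarrow> 'x \<Rightarrow> 'x"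
  rhs :: "'y set"
  rel :: "('x \<times> 'y) set"

definition up :: "'x set \<Rightarrow> 'y set \<Rightarrow> ('x \<times> 'y) set \<Rightarrow> 'x set \<Rightarrow> 'y set" where
  "up X Y r A = {y \<in> Y. \<forall>a \<in> A. (a, y) \<in> r}"

definition down :: "'x set \<Rightarrow> 'y set \<Rightarrow> ('x \<times> 'y) set \<Rightarrow> 'y set \<Rightarrow> 'x set" where
  "down X Y r B = {x \<in> X. \<forall>b \<in> B. (x, b) \<in> r}"

abbreviation rup :: "('x, 'y) srel \<Rightarrow> 'x set \<Rightarrow> 'y set" where
  "rup R \<equiv> up (lhs R) (rhs R) (rel R)"

abbreviation rdown :: "('x, 'y) srel \<Rightarrow> 'y set \<Rightarrow> 'x set" where
  "rdown R \<equiv> down (lhs R) (rhs R) (rel R)"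

definition extents :: "('x, 'y) srel \<Rightarrow> 'x set set" where
  "extents R = {A. A \<subseteq> lhs R \<and> A = rdown R (rup R A)}"

definition intents :: "('x, 'y) srel \<Rightarrow> 'y set set" where
  "intents R = {B. B \<subseteq> rhs R \<and> B = rup R (rdown R B)}"

locale residuated_relation =
  fixes R :: "('x, 'y) srel"
  assumes smult_closed: "\<lbrakk>x \<in> lhs R; x' \<in> lhs R\<rbrakk> \<Longrightarrow> smult R x x' \<in> lhs R"
    and smult_assoc: "\<lbrakk>x \<in> lhs R; x' \<in> lhs R; x'' \<in> lhs R\<rbrakk>
      \<Longrightarrow> smult R (smult R x x') x'' = smult R x (smult R x' x'')"
    and rel_subset: "rel R \<subseteq> lhs R \<times> rhs R"
    and residuated: "\<exists>swl swr.
      (\<forall>x \<in> lhs R. \<forall>y \<in> rhs R. swl y x \<in> rhs R \<and> swr x y \<in> rhs R) \<and>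
      (\<forall>x \<in> lhs R. \<forall>x' \<in> lhs R. \<forall>y \<in> rhs R.
        ((smult R x x', y) \<in> rel R \<longleftrightarrow> (x, swl y x') \<in> rel R) \<and>
        ((smult R x x', y) \<in> rel R \<longleftrightarrow> (x', swr x y) \<in> rel R))"

definition set_mult :: "('x, 'y) srel \<Rightarrow> 'x set \<Rightarrow> 'x set \<Rightarrow> 'x set" where
  "set_mult R A B = {smult R a b | a b. a \<in> A \<and> b \<in> B}"

definition concept_quantale :: "('x, 'y) srel \<Rightarrow> 'x set quant" where
  "concept_quantale R = \<lparr>
     carrier = extents R,
     eq = (=),
     le = (\<subseteq>),
     qtimes = (\<lambda>A B. rdown R (rup R (set_mult R A B)))\<rparr>"

definition intent_mult :: "('x, 'y) srel \<Rightarrow> 'y set \<Rightarrow> 'y set \<Rightarrow> 'y set" where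
  "intent_mult S P Q = rup S (set_mult S (rdown S P) (rdown S Q))"


section \<open>Multiplicative bonds\<close>

abbreviation row :: "('x \<times> 'w) set \<Rightarrow> 'x \<Rightarrow> 'w set" where
  "row b x \<equiv> {w. (x, w) \<in> b}"

abbreviation column :: "('x \<times> 'w) set \<Rightarrow> 'w \<Rightarrow> 'x set" where
  "column b w \<equiv> {x. (x, w) \<in> b}"

definition bonds :: "('x, 'y) srel \<Rightarrow> ('z, 'w) srel \<Rightarrow> ('x \<times> 'w) set set" where
  "bonds R S = {b. b \<subseteq> lhs R \<times> rhs S \<and>
    (\<forall>x \<in> lhs R. row b x \<in> intents S) \<and>
    (\<forall>w \<in> rhs S. column b w \<in> extents R)}"

definition mult_bonds :: "('x, 'y) srel \<Rightarrow> ('z, 'w) srel \<Rightarrow> ('x \<times> 'w) set set" where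
  "mult_bonds R S = {b \<in> bonds R S. \<forall>x \<in> lhs R. \<forall>x' \<in> lhs R.
    row b (smult R x x') = intent_mult S (row b x) (row b x')}"

definition bond_comp :: "('x, 'y) srel \<Rightarrow> ('z, 'w) srel \<Rightarrow> ('u, 'v) srel \<Rightarrow>
    ('z \<times> 'v) set \<Rightarrow> ('x \<times> 'w) set \<Rightarrow> ('x \<times> 'v) set" where
  "bond_comp R S T c b =
    {(x, v). x \<in> lhs R \<and> v \<in> rhs T \<and> rdown S (row b x) \<subseteq> column c v}"

definition bond_map :: "('x, 'y) srel \<Rightarrow> ('z, 'w) srel \<Rightarrow> ('x \<times> 'w) set \<Rightarrow> 'x set \<Rightarrow> 'z set" where
  "bond_map R S b = (\<lambda>A \<in> extents R. rdown S (up (lhs R) (rhs S) b A))"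

text \<open>The set of extents has to be small along with the two underlying sets, because the
  concept quantale must lie in the same universe. If \<open>\<U>\<close> is closed under power sets and
  subsets, as a Grothendieck universe is, this holds automatically; see \<open>small_extents\<close>.\<close>

definition ResRel :: "'u set set \<Rightarrow> (('x, 'y) srel, ('x \<times> 'y) set) cat" where
  "ResRel \<U> = \<lparr>
     Obj = {R. residuated_relation R \<and> small \<U> (lhs R) \<and> small \<U> (rhs R) \<and> small \<U> (extents R)},
     Hom = mult_bonds,
     Id = rel,
     Comp = bond_comp\<rparr>"

lemma small_extents:
  assumes Pow: "\<And>A. A \<in> \<U> \<Longrightarrow> small \<U> (Pow A)"
    and sub: "\<And>A B. A \<in> \<U> \<Longrightarrow> B \<subseteq> A \<Longrightarrow> B \<in> \<U>"
    and R: "small \<U> (lhs R)"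
  shows "small \<U> (extents R)"
proof -
  obtain A where A: "A \<in> \<U>" "lhs R \<approx> A"
    using R by (auto simp: small_def)
  obtain B where B: "B \<in> \<U>" "Pow A \<approx> B"
    using Pow[OF A(1)] by (auto simp: small_def)
  obtain f where f: "bij_betw f (lhs R) A"
    using A(2) by (auto simp: eqpoll_def)
  have "Pow (lhs R) \<approx> Pow A"
    using bij_betw_Pow[OF f] by (auto simp: eqpoll_def)
  then have "Pow (lhs R) \<approx> B"
    using B(2) eqpoll_trans by blast
  then obtain g where g: "bij_betw g (Pow (lhs R)) B"
    by (auto simp: eqpoll_def)
  have sub_ext: "extents R \<subseteq> Pow (lhs R)"
    by (auto simp: extents_def)
  have "extents R \<approx> g ` extents R"
    using bij_betw_subset[OF g sub_ext refl] by (auto simp: eqpoll_def)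
  moreover have "g ` extents R \<in> \<U>"
    using sub[OF B(1)] image_mono[OF sub_ext, of g] bij_betw_imp_surj_on[OF g] by simp
  ultimately show ?thesis
    by (auto simp: small_def)
qed

definition concept_functor ::
    "(('u, 'v) srel, ('u \<times> 'v) set, 'u set quant, 'u set \<Rightarrow> 'u set) fun_data" where
  "concept_functor = \<lparr>obj_map = concept_quantale, arr_map = bond_map\<rparr>"

end

theory Submission
  imports Defs
begin

text \<open>A bond \<open>b\<close> is recovered from \<open>b\<^sub>*\<close> by evaluating at the closures of singletons, since
  \<open>b\<^sub>*\<close> sends the closure of \<open>{x}\<close> to the polar of the row \<open>b[x]\<close>. Conversely these closures are
  join-dense in \<open>MR\<close>, so every quantale homomorphism \<open>MR \<rightarrow> MS\<close> arises from the bond obtained by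
  this evaluation; hence \<open>M\<close> is fully faithful. It is essentially surjective because a
  quantale \<open>Q\<close> is isomorphic to the concept quantale of its own order relation, transported along
  a bijection from \<open>Q\<close> to a member of the universe: its extents are the principal down-sets, and
  the residuals of \<open>Q\<close> witness residuation.\<close>

section \<open>Fully faithful and essentially surjective functors\<close>

lemma (in category) cat_functor_id: "cat_functor C C id_fun"
  by unfold_locales (auto simp: id_fun_def)

lemma cat_functor_comp:
  assumes "cat_functor C D F" "cat_functor D E G"
  shows "cat_functor C E (comp_fun G F)"
proof -
  interpret F: cat_functor C D F by fact
  interpret G: cat_functor D E G by fact
  show ?thesis
    by unfold_locales
      (auto simp: comp_fun_def F.obj_map_in_Obj F.arr_map_in_Hom F.arr_map_Id F.arr_map_Comp
        G.obj_map_in_Obj G.arr_map_in_Hom G.arr_map_Id G.arr_map_Comp)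
qed

text \<open>Choice turns essential surjectivity into objects \<open>g d\<close> with isomorphisms
  \<open>e d\<close>. The quasi-inverse sends an arrow to its conjugate by these isomorphisms,
  pulled back through the hom-set bijections of \<open>F\<close>. The family \<open>e\<close> serves
  as counit; the unit is the preimage of the inverses \<open>e'\<close>.\<close>

lemma equivalence_of_categoriesI:
  assumes F: "cat_functor C D F"
    and fully_faithful: "\<And>a b. \<lbrakk>a \<in> Obj C; b \<in> Obj C\<rbrakk>
      \<Longrightarrow> bij_betw (arr_map F a b) (Hom C a b) (Hom D (obj_map F a) (obj_map F b))"
    and ess_surj: "\<And>d. d \<in> Obj D \<Longrightarrow> \<exists>a \<in> Obj C. \<exists>f. iso_arrow D (obj_map F a) d f"
  shows "equivalence_of_categories C D F"
proof -
  interpret F: cat_functor C D F by fact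
  let ?F = "obj_map F"
  have "\<forall>d. \<exists>a f f'. d \<in> Obj D \<longrightarrow> a \<in> Obj C \<and> f \<in> Hom D (?F a) d \<and> f' \<in> Hom D d (?F a) \<and>
      Comp D (?F a) d (?F a) f' f = Id D (?F a) \<and> Comp D d (?F a) d f f' = Id D d"
    using ess_surj unfolding iso_arrow_def by meson
  then obtain g e e' where "\<forall>d. d \<in> Obj D \<longrightarrow> g d \<in> Obj C \<and> e d \<in> Hom D (?F (g d)) d \<and>
      e' d \<in> Hom D d (?F (g d)) \<and>
      Comp D (?F (g d)) d (?F (g d)) (e' d) (e d) = Id D (?F (g d)) \<and>
      Comp D d (?F (g d)) d (e d) (e' d) = Id D d"
    by metis
  then have g: "g d \<in> Obj C" and e: "e d \<in> Hom D (?F (g d)) d" and e': "e' d \<in> Hom D d (?F (g d))"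
    and e'_e: "Comp D (?F (g d)) d (?F (g d)) (e' d) (e d) = Id D (?F (g d))"
    and e_e': "Comp D d (?F (g d)) d (e d) (e' d) = Id D d"
    if "d \<in> Obj D" for d
    using that by blast+

  define J where "J a b = the_inv_into (Hom C a b) (arr_map F a b)" for a b
  have J: "J a b k \<in> Hom C a b" and F_J: "arr_map F a b (J a b k) = k"
    if "a \<in> Obj C" "b \<in> Obj C" "k \<in> Hom D (?F a) (?F b)" for a b k
    using fully_faithful[OF that(1,2)] that(3) bij_betw_the_inv_into[OF fully_faithful[OF that(1,2)]]
    by (auto simp: J_def f_the_inv_into_f_bij_betw bij_betw_def)
  have faithful: "f = f'"
    if "arr_map F a b f = arr_map F a b f'" "f \<in> Hom C a b" "f' \<in> Hom C a b"
      "a \<in> Obj C" "b \<in> Obj C" for a b f f'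
    using fully_faithful[OF that(4,5)] that(1-3) by (auto simp: bij_betw_def dest: inj_onD)

  note D_simps = F.obj_map_in_Obj F.arr_map_in_Hom g e e' e'_e e_e' F.target.Comp_in_Hom
    F.target.Id_in_Hom F.target.Comp_Id_left F.target.Comp_Id_right F.target.Comp_assoc
  note F_simps = F_J F.arr_map_Id F.arr_map_Comp F.source.Comp_in_Hom F.source.Id_in_Hom J
  \<comment> \<open>Equations in \<open>C\<close> are checked after applying \<open>F\<close>, where
    \<open>J\<close> disappears; faithfulness brings them back.\<close>
  have J_Id: "J a a (Id D (?F a)) = Id C a" if "a \<in> Obj C" for a
    by (rule faithful[where a = a and b = a]) (use that in \<open>simp_all add: F_simps D_simps\<close>)
  have J_Comp: "J a c (Comp D (?F a) (?F b) (?F c) k' k) = Comp C a b c (J b c k') (J a b k)"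
    if "a \<in> Obj C" "b \<in> Obj C" "c \<in> Obj C" "k \<in> Hom D (?F a) (?F b)" "k' \<in> Hom D (?F b) (?F c)"
    for a b c k k'
    by (rule faithful[where a = a and b = c]) (use that in \<open>simp_all add: F_simps D_simps\<close>)
  \<comment> \<open>Associativity is oriented towards left-nested composites, so cancelling
    \<open>e d\<close> against \<open>e' d\<close> needs this form with an arrow \<open>k\<close> in
    front.\<close>
  have e_e'_cancel: "Comp D d (?F (g d)) x (Comp D (?F (g d)) d x k (e d)) (e' d) = k"
    if "d \<in> Obj D" "x \<in> Obj D" "k \<in> Hom D d x" for d x k
    using that by (simp add: D_simps flip: F.target.Comp_assoc)

  \<comment> \<open>Conjugation: \<open>e' d'\<close> after \<open>k\<close> after
    \<open>e d\<close>. In a composite of two conjugates the inner pair cancels, which makes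
    \<open>H\<close> functorial.\<close>
  define H where "H d d' k = Comp D (?F (g d)) d (?F (g d'))
    (Comp D d d' (?F (g d')) (e' d') k) (e d)" for d d' k
  have H_in: "H d d' k \<in> Hom D (?F (g d)) (?F (g d'))"
    if "d \<in> Obj D" "d' \<in> Obj D" "k \<in> Hom D d d'" for d d' k
    using that by (simp add: H_def D_simps)
  have H_Id: "H d d (Id D d) = Id D (?F (g d))" if "d \<in> Obj D" for d
    using that by (simp add: H_def D_simps)
  have H_Comp: "H d d'' (Comp D d d' d'' k' k) =
      Comp D (?F (g d)) (?F (g d')) (?F (g d'')) (H d' d'' k') (H d d' k)"
    if "d \<in> Obj D" "d' \<in> Obj D" "d'' \<in> Obj D" "k \<in> Hom D d d'" "k' \<in> Hom D d' d''"
    for d d' d'' k k'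
    using that by (simp add: H_def D_simps e_e'_cancel)

  define G where "G = \<lparr>obj_map = g, arr_map = (\<lambda>d d' k. J (g d) (g d') (H d d' k))\<rparr>"
  interpret G: cat_functor D C G
    by unfold_locales (auto simp: G_def H_in H_Id H_Comp J_Id J_Comp J D_simps)

  \<comment> \<open>The arrow \<open>e' (?F a)\<close> runs from \<open>?F a\<close> to
    \<open>?F (g (?F a))\<close>; fullness lifts it to \<open>C\<close>.\<close>
  define \<eta> where "\<eta> a = J a (g (?F a)) (e' (?F a))" for a
  have iso_\<eta>: "iso_arrow C a (g (?F a)) (\<eta> a)" if a: "a \<in> Obj C" for a
  proof -
    have "J (g (?F a)) a (e (?F a)) \<in> Hom C (g (?F a)) a"
      using a by (simp add: F_simps D_simps)
    moreover have "Comp C a (g (?F a)) a (J (g (?F a)) a (e (?F a))) (\<eta> a) = Id C a"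
      by (rule faithful[where a = a and b = a])
        (use a in \<open>simp_all add: \<eta>_def F_simps D_simps\<close>)
    moreover have "Comp C (g (?F a)) a (g (?F a)) (\<eta> a) (J (g (?F a)) a (e (?F a))) = Id C (g (?F a))"
      by (rule faithful[where a = "g (?F a)" and b = "g (?F a)"])
        (use a in \<open>simp_all add: \<eta>_def F_simps D_simps\<close>)
    moreover have "\<eta> a \<in> Hom C a (g (?F a))"
      using a by (simp add: \<eta>_def F_simps D_simps)
    ultimately show ?thesis
      unfolding iso_arrow_def by blast
  qed
  \<comment> \<open>Under \<open>F\<close> the right-hand side becomes the conjugate of
    \<open>arr_map F a b f\<close> preceded by \<open>e' (?F a)\<close>, and \<open>e (?F a)\<close>
    cancels.\<close>
  have nat_\<eta>: "Comp C a b (g (?F b)) (\<eta> b) f =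
      Comp C a (g (?F a)) (g (?F b)) (arr_map G (?F a) (?F b) (arr_map F a b f)) (\<eta> a)"
    if "a \<in> Obj C" "b \<in> Obj C" "f \<in> Hom C a b" for a b f
    by (rule faithful[where a = a and b = "g (?F b)"])
      (use that H_in[of "?F a" "?F b" "arr_map F a b f"] in
        \<open>simp_all add: \<eta>_def G_def F_simps D_simps, simp add: H_def D_simps e_e'_cancel\<close>)
  have "natural_iso C C id_fun (comp_fun G F) \<eta>"
    by (intro natural_iso.intro natural_iso_axioms.intro F.source.cat_functor_id cat_functor_comp[OF F]
        G.cat_functor_axioms)
      (use iso_\<eta> nat_\<eta> in \<open>auto simp: id_fun_def comp_fun_def G_def\<close>)
  moreover have "natural_iso D D (comp_fun F G) id_fun e"
  proof (intro natural_iso.intro natural_iso_axioms.intro F.target.cat_functor_id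
      cat_functor_comp[OF _ F] G.cat_functor_axioms)
    show "iso_arrow D (obj_map (comp_fun F G) d) (obj_map id_fun d) (e d)" if "d \<in> Obj D" for d
      using e[OF that] e'[OF that] e'_e[OF that] e_e'[OF that]
      by (auto simp: iso_arrow_def comp_fun_def id_fun_def G_def)
    show "Comp D (obj_map (comp_fun F G) a) (obj_map (comp_fun F G) b) (obj_map id_fun b) (e b)
        (arr_map (comp_fun F G) a b f) =
      Comp D (obj_map (comp_fun F G) a) (obj_map id_fun a) (obj_map id_fun b)
        (arr_map id_fun a b f) (e a)"
      if "a \<in> Obj D" "b \<in> Obj D" "f \<in> Hom D a b" for a b f
      using that H_in[of a b f]
      by (simp add: comp_fun_def id_fun_def G_def F_simps D_simps) (simp add: H_def D_simps)
  qed
  ultimately show ?thesis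
    unfolding equivalence_of_categories_def using F G.cat_functor_axioms by blast
qed

section \<open>Suprema in quantales\<close>

lemma (in complete_lattice) sup_eqI:
  assumes "A \<subseteq> carrier L" "s \<in> carrier L" "\<And>a. a \<in> A \<Longrightarrow> a \<sqsubseteq> s"
    "\<And>u. \<lbrakk>u \<in> carrier L; \<And>a. a \<in> A \<Longrightarrow> a \<sqsubseteq> u\<rbrakk> \<Longrightarrow> s \<sqsubseteq> u"
  shows "\<Squnion>A = s"
proof (rule le_antisym)
  show "\<Squnion>A \<sqsubseteq> s"
    using assms by (intro sup_least) (auto simp: Upper_def)
  show "s \<sqsubseteq> \<Squnion>A"
    using assms(1) by (intro assms(4) sup_closed sup_upper)
qed (use assms in simp_all)

text \<open>An inequality says that the larger element is the supremum of the pair, and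
  multiplication preserves such suprema in each variable.\<close>

lemma (in quantale) qtimes_mono:
  assumes "x \<sqsubseteq> x'" "y \<sqsubseteq> y'" and carr: "x \<in> carrier Q" "x' \<in> carrier Q" "y \<in> carrier Q" "y' \<in> carrier Q"
  shows "x \<cdot> y \<sqsubseteq> x' \<cdot> y'"
proof -
  have "x' = \<Squnion>{x, x'}" "y' = \<Squnion>{y, y'}"
    using assms by (auto intro!: sup_eqI[symmetric])
  then have sups: "x' \<cdot> y = \<Squnion>{x \<cdot> y, x' \<cdot> y}" "x' \<cdot> y' = \<Squnion>{x' \<cdot> y, x' \<cdot> y'}"
    using qtimes_Sup_left[of y "{x, x'}"] qtimes_Sup_right[of x' "{y, y'}"] carr by auto
  have "x \<cdot> y \<sqsubseteq> x' \<cdot> y"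
    by (subst sups(1), rule sup_upper) (simp_all add: qtimes_closed carr)
  moreover have "x' \<cdot> y \<sqsubseteq> x' \<cdot> y'"
    by (subst sups(2), rule sup_upper) (simp_all add: qtimes_closed carr)
  ultimately show ?thesis
    by (rule le_trans) (simp_all add: qtimes_closed carr)
qed

lemma quantale_homD:
  assumes "f \<in> quantale_hom P Q"
  shows "x \<in> carrier P \<Longrightarrow> f x \<in> carrier Q"
    and "A \<subseteq> carrier P \<Longrightarrow> f (\<Squnion>\<^bsub>P\<^esub>A) = \<Squnion>\<^bsub>Q\<^esub>(f ` A)"
    and "\<lbrakk>x \<in> carrier P; y \<in> carrier P\<rbrakk> \<Longrightarrow> f (x \<cdot>\<^bsub>P\<^esub> y) = f x \<cdot>\<^bsub>Q\<^esub> f y"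
    and "f \<in> extensional (carrier P)"
  using assms by (auto simp: quantale_hom_def PiE_def)

text \<open>Again the larger element is written as the supremum of the pair, since homomorphisms are
  defined by suprema and products only.\<close>

lemma quantale_hom_mono:
  assumes "quantale P" "quantale Q" and f: "f \<in> quantale_hom P Q"
    and xy: "x \<sqsubseteq>\<^bsub>P\<^esub> y" "x \<in> carrier P" "y \<in> carrier P"
  shows "f x \<sqsubseteq>\<^bsub>Q\<^esub> f y"
proof -
  interpret P: quantale P by fact
  interpret Q: quantale Q by fact
  have f_in: "f x \<in> carrier Q" "f y \<in> carrier Q"
    using quantale_homD(1)[OF f] xy by auto
  have "y = \<Squnion>\<^bsub>P\<^esub>{x, y}"
    using xy by (auto intro!: P.sup_eqI[symmetric])
  then have "f y = f (\<Squnion>\<^bsub>P\<^esub>{x, y})"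
    by (rule arg_cong)
  also have "\<dots> = \<Squnion>\<^bsub>Q\<^esub>{f x, f y}"
    using xy quantale_homD(2)[OF f, of "{x, y}"] by simp
  finally have fy: "f y = \<Squnion>\<^bsub>Q\<^esub>{f x, f y}" .
  show ?thesis
    by (subst fy, rule Q.sup_upper) (use f_in in auto)
qed

text \<open>Only suprema need an argument: an upper bound of the image is \<open>f v\<close> for
  some \<open>v\<close>, and \<open>v\<close> bounds the original set because \<open>f\<close>
  reflects the order.\<close>

lemma quantale_hom_of_order_iso:
  assumes "quantale P" "quantale Q" and bij: "bij_betw f (carrier P) (carrier Q)"
    and le: "\<And>x y. \<lbrakk>x \<in> carrier P; y \<in> carrier P\<rbrakk> \<Longrightarrow> f x \<sqsubseteq>\<^bsub>Q\<^esub> f y \<longleftrightarrow> x \<sqsubseteq>\<^bsub>P\<^esub> y"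
    and mult: "\<And>x y. \<lbrakk>x \<in> carrier P; y \<in> carrier P\<rbrakk> \<Longrightarrow> f (x \<cdot>\<^bsub>P\<^esub> y) = f x \<cdot>\<^bsub>Q\<^esub> f y"
  shows "restrict f (carrier P) \<in> quantale_hom P Q"
proof -
  interpret P: quantale P by fact
  interpret Q: quantale Q by fact
  have f_in: "f x \<in> carrier Q" if "x \<in> carrier P" for x
    using bij that by (auto simp: bij_betw_def)
  have "f (\<Squnion>\<^bsub>P\<^esub>A) = \<Squnion>\<^bsub>Q\<^esub>(f ` A)" if A: "A \<subseteq> carrier P" for A
  proof (rule Q.sup_eqI[symmetric])
    show "f (\<Squnion>\<^bsub>P\<^esub>A) \<sqsubseteq>\<^bsub>Q\<^esub> u" if u: "u \<in> carrier Q" "\<And>a. a \<in> f ` A \<Longrightarrow> a \<sqsubseteq>\<^bsub>Q\<^esub> u" for u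
    proof -
      obtain v where v: "v \<in> carrier P" "u = f v"
        using bij u(1) by (auto simp: bij_betw_def)
      then have "x \<sqsubseteq>\<^bsub>P\<^esub> v" if "x \<in> A" for x
        using u(2)[of "f x"] le[of x v] A that by auto
      then have "\<Squnion>\<^bsub>P\<^esub>A \<sqsubseteq>\<^bsub>P\<^esub> v"
        using A v(1) by (intro P.sup_least) (auto simp: Upper_def)
      then show ?thesis
        using v le A by simp
    qed
  qed (use A f_in le P.sup_upper in \<open>auto simp: subset_iff\<close>)
  then show ?thesis
    using f_in mult P.qtimes_closed by (auto simp: quantale_hom_def subset_iff)
qed

section \<open>Concept quantales\<close>

text \<open>The closure operator of the Galois connection between \<open>rup R\<close> and
  \<open>rdown R\<close>; its fixed points are the extents.\<close>

definition cl :: "('x, 'y) srel \<Rightarrow> 'x set \<Rightarrow> 'x set" where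
  "cl R A = rdown R (rup R A)"

lemma cl_subset_lhs: "cl R A \<subseteq> lhs R"
  by (auto simp: cl_def down_def)

lemma cl_extensive: "A \<subseteq> lhs R \<Longrightarrow> A \<subseteq> cl R A"
  by (auto simp: cl_def down_def up_def)

lemma cl_mono: "A \<subseteq> B \<Longrightarrow> cl R A \<subseteq> cl R B"
  by (auto simp: cl_def down_def up_def)

lemma up_cl: "A \<subseteq> lhs R \<Longrightarrow> rup R (cl R A) = rup R A"
  by (auto simp: cl_def down_def up_def)

lemma down_up_down: "B \<subseteq> rhs R \<Longrightarrow> rdown R (rup R (rdown R B)) = rdown R B"
  by (auto simp: down_def up_def)

lemma rdown_extent: "B \<subseteq> rhs R \<Longrightarrow> rdown R B \<in> extents R"
  using down_up_down[of B R] by (auto simp: extents_def down_def)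

lemma rup_subset_rhs: "rup R A \<subseteq> rhs R"
  by (auto simp: up_def)

lemma cl_extent: "cl R A \<in> extents R"
  unfolding cl_def by (rule rdown_extent[OF rup_subset_rhs])

lemma extentD: "E \<in> extents R \<Longrightarrow> E \<subseteq> lhs R" "E \<in> extents R \<Longrightarrow> cl R E = E"
  by (auto simp: extents_def cl_def)

lemma cl_least: "\<lbrakk>A \<subseteq> E; E \<in> extents R\<rbrakk> \<Longrightarrow> cl R A \<subseteq> E"
  using cl_mono[of A E R] by (simp add: extentD)

text \<open>Suprema of extents are closures of unions, so this is how closures of the members are
  dropped or inserted inside a supremum. Each inner closure lies below the closure of the whole
  union, which is an extent.\<close>

lemma cl_UN_cl:
  assumes "\<And>i. i \<in> I \<Longrightarrow> A i \<subseteq> lhs R"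
  shows "cl R (\<Union>i\<in>I. cl R (A i)) = cl R (\<Union>i\<in>I. A i)"
proof
  show "cl R (\<Union>i\<in>I. cl R (A i)) \<subseteq> cl R (\<Union>i\<in>I. A i)"
    by (intro cl_least cl_extent UN_least cl_mono) blast
  show "cl R (\<Union>i\<in>I. A i) \<subseteq> cl R (\<Union>i\<in>I. cl R (A i))"
    by (intro cl_mono UN_mono cl_extensive assms order_refl)
qed

text \<open>Join-density of singleton closures: for an extent \<open>A\<close> the right-hand side
  is \<open>A\<close> itself.\<close>

lemma UN_cl_singletons: "A \<subseteq> lhs R \<Longrightarrow> cl R (\<Union>x\<in>A. cl R {x}) = cl R A"
  using cl_UN_cl[of A "\<lambda>x. {x}" R] by auto

lemma set_mult_UN_left: "set_mult R (\<Union>i\<in>I. A i) B = (\<Union>i\<in>I. set_mult R (A i) B)"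
  and set_mult_UN_right: "set_mult R B (\<Union>i\<in>I. A i) = (\<Union>i\<in>I. set_mult R B (A i))"
  by (auto simp: set_mult_def)

section \<open>Products of subsets and their closures\<close>

context residuated_relation
begin

lemma set_mult_subset_lhs: "\<lbrakk>A \<subseteq> lhs R; B \<subseteq> lhs R\<rbrakk> \<Longrightarrow> set_mult R A B \<subseteq> lhs R"
  using smult_closed by (auto simp: set_mult_def)

lemma set_mult_assoc:
  assumes "A \<subseteq> lhs R" "B \<subseteq> lhs R" "C \<subseteq> lhs R"
  shows "set_mult R (set_mult R A B) C = set_mult R A (set_mult R B C)"
proof -
  \<comment> \<open>Both sides are unions over triples, which reduces the claim to associativity of
    elements.\<close>
  have "set_mult R (set_mult R A B) C = (\<Union>a\<in>A. \<Union>b\<in>B. \<Union>c\<in>C. {smult R (smult R a b) c})"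
    unfolding set_mult_def by blast
  also have "\<dots> = (\<Union>a\<in>A. \<Union>b\<in>B. \<Union>c\<in>C. {smult R a (smult R b c)})"
    using assms by (intro SUP_cong refl) (simp add: smult_assoc subset_iff)
  also have "\<dots> = set_mult R A (set_mult R B C)"
    unfolding set_mult_def by blast
  finally show ?thesis .
qed

text \<open>Closing one factor leaves the polar unchanged: residuation turns \<open>(ab) R y\<close> into a
  condition of the form \<open>a R y'\<close>, which passes from \<open>A\<close> to its closure.\<close>

lemma rup_set_mult_cl:
  assumes A: "A \<subseteq> lhs R" and B: "B \<subseteq> lhs R"
  shows "rup R (set_mult R (cl R A) (cl R B)) = rup R (set_mult R A B)"
proof -
  obtain swl swr where
    "\<forall>x \<in> lhs R. \<forall>y \<in> rhs R. swl y x \<in> rhs R \<and> swr x y \<in> rhs R"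
    "\<forall>x \<in> lhs R. \<forall>x' \<in> lhs R. \<forall>y \<in> rhs R.
      ((smult R x x', y) \<in> rel R \<longleftrightarrow> (x, swl y x') \<in> rel R) \<and>
      ((smult R x x', y) \<in> rel R \<longleftrightarrow> (x', swr x y) \<in> rel R)"
    using residuated by (elim exE conjE)
  then have res: "swl y x \<in> rhs R" "swr x y \<in> rhs R"
      "(smult R x x', y) \<in> rel R \<longleftrightarrow> (x, swl y x') \<in> rel R"
      "(smult R x x', y) \<in> rel R \<longleftrightarrow> (x', swr x y) \<in> rel R"
    if "x \<in> lhs R" "x' \<in> lhs R" "y \<in> rhs R" for x x' y
    using that by blast+
  have left: "y \<in> rup R (set_mult R (cl R A) B)"
    if "y \<in> rup R (set_mult R A B)" "A \<subseteq> lhs R" "B \<subseteq> lhs R" for y A B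
  proof -
    have y: "y \<in> rhs R" "\<And>a b. \<lbrakk>a \<in> A; b \<in> B\<rbrakk> \<Longrightarrow> (smult R a b, y) \<in> rel R"
      using that(1) by (auto simp: up_def set_mult_def)
    have "(smult R a b, y) \<in> rel R" if ab: "a \<in> cl R A" "b \<in> B" for a b
    proof -
      have b: "b \<in> lhs R" and a: "a \<in> lhs R"
        using ab \<open>B \<subseteq> lhs R\<close> cl_subset_lhs[of R A] by auto
      have "swl y b \<in> rup R A"
        using res(1)[OF b b y(1)] res(3)[OF _ b y(1)] y(2) \<open>A \<subseteq> lhs R\<close> ab(2)
        by (auto simp: up_def subset_iff)
      then have "(a, swl y b) \<in> rel R"
        using ab(1) by (auto simp: cl_def down_def)
      then show ?thesis
        using res(3)[OF a b y(1)] by simp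
    qed
    then show ?thesis
      using y(1) by (auto simp: up_def set_mult_def)
  qed
  have right: "y \<in> rup R (set_mult R A (cl R B))"
    if "y \<in> rup R (set_mult R A B)" "A \<subseteq> lhs R" "B \<subseteq> lhs R" for y A B
  proof -
    have y: "y \<in> rhs R" "\<And>a b. \<lbrakk>a \<in> A; b \<in> B\<rbrakk> \<Longrightarrow> (smult R a b, y) \<in> rel R"
      using that(1) by (auto simp: up_def set_mult_def)
    have "(smult R a b, y) \<in> rel R" if ab: "a \<in> A" "b \<in> cl R B" for a b
    proof -
      have a: "a \<in> lhs R" and b: "b \<in> lhs R"
        using ab \<open>A \<subseteq> lhs R\<close> cl_subset_lhs[of R B] by auto
      have "swr a y \<in> rup R B"
        using res(2)[OF a a y(1)] res(4)[OF a _ y(1)] y(2) \<open>B \<subseteq> lhs R\<close> ab(1)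
        by (auto simp: up_def subset_iff)
      then have "(b, swr a y) \<in> rel R"
        using ab(2) by (auto simp: cl_def down_def)
      then show ?thesis
        using res(4)[OF a b y(1)] by simp
    qed
    then show ?thesis
      using y(1) by (auto simp: up_def set_mult_def)
  qed
  show ?thesis
  proof
    \<comment> \<open>The left factor is closed first; \<open>right\<close> is then applied with
      \<open>cl R A\<close> in place of \<open>A\<close>.\<close>
    show "rup R (set_mult R A B) \<subseteq> rup R (set_mult R (cl R A) (cl R B))"
      by (intro subsetI right[OF left] cl_subset_lhs A B)
    show "rup R (set_mult R (cl R A) (cl R B)) \<subseteq> rup R (set_mult R A B)"
      using cl_extensive[OF A] cl_extensive[OF B] unfolding up_def set_mult_def by blast
  qed
qed

text \<open>This makes \<open>cl R\<close> a nucleus on the quantale of subsets of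
  \<open>lhs R\<close>, so associativity and distributivity pass from products of subsets to
  extents.\<close>

lemma cl_set_mult_cl:
  "\<lbrakk>A \<subseteq> lhs R; B \<subseteq> lhs R\<rbrakk> \<Longrightarrow> cl R (set_mult R (cl R A) (cl R B)) = cl R (set_mult R A B)"
  unfolding cl_def using rup_set_mult_cl by (simp add: cl_def)

end

section \<open>The quantale of extents\<close>

lemma concept_quantale_simps:
  "carrier (concept_quantale R) = extents R"
  "A \<sqsubseteq>\<^bsub>concept_quantale R\<^esub> B \<longleftrightarrow> A \<subseteq> B"
  "A \<cdot>\<^bsub>concept_quantale R\<^esub> B = cl R (set_mult R A B)"
  by (simp_all add: concept_quantale_def cl_def)

lemma extents_lub:
  assumes "\<A> \<subseteq> extents R"
  shows "A \<in> \<A> \<Longrightarrow> A \<subseteq> cl R (\<Union>\<A>)"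
    and "\<lbrakk>E \<in> extents R; \<And>A. A \<in> \<A> \<Longrightarrow> A \<subseteq> E\<rbrakk> \<Longrightarrow> cl R (\<Union>\<A>) \<subseteq> E"
proof -
  have "\<Union>\<A> \<subseteq> lhs R"
    using assms extentD(1) by blast
  then show "A \<in> \<A> \<Longrightarrow> A \<subseteq> cl R (\<Union>\<A>)"
    using cl_extensive by blast
qed (intro cl_least Union_least)

lemma complete_lattice_concept_quantale: "complete_lattice (concept_quantale R)"
proof -
  interpret partial_order "concept_quantale R"
    by unfold_locales (auto simp: concept_quantale_def)
  show ?thesis
  proof (unfold_locales)
    fix A assume "A \<subseteq> carrier (concept_quantale R)"
    then have A: "A \<subseteq> extents R"
      by (simp add: concept_quantale_simps)
    have "least (concept_quantale R) (cl R (\<Union>A)) (Upper (concept_quantale R) A)"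
    proof (rule least_UpperI, unfold concept_quantale_simps)
      show "cl R (\<Union>A) \<subseteq> E" if "E \<in> Upper (concept_quantale R) A" for E
        by (rule extents_lub(2)[OF A])
          (use that A in \<open>auto simp: Upper_def concept_quantale_simps\<close>)
    qed (use A extents_lub(1)[OF A] in \<open>simp_all only: cl_extent\<close>)
    then show "\<exists>s. least (concept_quantale R) s (Upper (concept_quantale R) A)" ..
    have "cl R ` A = A"
      using A by (auto simp: extentD subset_iff image_iff)
    \<comment> \<open>An intersection of extents is the polar of a union of intents, hence again an
      extent; the factor \<open>lhs R\<close> gives the correct top element when the family is
      empty.\<close>
    moreover have "rdown R (\<Union>(rup R ` A)) = lhs R \<inter> \<Inter>(cl R ` A)"
      by (auto simp: cl_def down_def)
    moreover have "rdown R (\<Union>(rup R ` A)) \<in> extents R"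
      by (intro rdown_extent UN_least rup_subset_rhs)
    ultimately have inter: "lhs R \<inter> \<Inter>A \<in> extents R"
      by simp
    have "greatest (concept_quantale R) (lhs R \<inter> \<Inter>A) (Lower (concept_quantale R) A)"
    proof (rule greatest_LowerI, unfold concept_quantale_simps)
      show "E \<subseteq> lhs R \<inter> \<Inter>A" if "E \<in> Lower (concept_quantale R) A" for E
        using that A extentD(1)[of E R] by (auto simp: Lower_def concept_quantale_simps)
    qed (use A inter in auto)
    then show "\<exists>s. greatest (concept_quantale R) s (Lower (concept_quantale R) A)" ..
  qed
qed

lemma Sup_concept_quantale:
  assumes "A \<subseteq> extents R"
  shows "\<Squnion>\<^bsub>concept_quantale R\<^esub>A = cl R (\<Union>A)"
proof -
  interpret complete_lattice "concept_quantale R" by (rule complete_lattice_concept_quantale)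
  show ?thesis
    by (rule sup_eqI)
      (simp_all only: concept_quantale_simps assms cl_extent extents_lub[OF assms])
qed

lemma (in residuated_relation) quantale_concept_quantale: "quantale (concept_quantale R)"
proof (intro quantale.intro complete_lattice_concept_quantale quantale_axioms.intro,
    unfold concept_quantale_simps)
  show "cl R (set_mult R (cl R (set_mult R A B)) C) = cl R (set_mult R A (cl R (set_mult R B C)))"
    if "A \<in> extents R" "B \<in> extents R" "C \<in> extents R" for A B C
  proof -
    have sub: "A \<subseteq> lhs R" "B \<subseteq> lhs R" "C \<subseteq> lhs R"
      using that extentD(1) by auto
    have "cl R (set_mult R (cl R (set_mult R A B)) C) = cl R (set_mult R (set_mult R A B) C)"
      using cl_set_mult_cl[of "set_mult R A B" C] sub that set_mult_subset_lhs by (simp add: extentD)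
    also have "set_mult R (set_mult R A B) C = set_mult R A (set_mult R B C)"
      using sub by (rule set_mult_assoc)
    also have "cl R \<dots> = cl R (set_mult R A (cl R (set_mult R B C)))"
      using cl_set_mult_cl[of A "set_mult R B C"] sub that set_mult_subset_lhs by (simp add: extentD)
    finally show ?thesis .
  qed
next
  fix A and \<A> assume A: "A \<in> extents R" and \<A>: "\<A> \<subseteq> extents R"
  have sub: "A \<subseteq> lhs R" "\<Union>\<A> \<subseteq> lhs R" and subs: "\<And>B. B \<in> \<A> \<Longrightarrow> B \<subseteq> lhs R"
    using A \<A> extentD(1) by blast+
  \<comment> \<open>Since \<open>A\<close> is its own closure, \<open>cl_set_mult_cl\<close> removes
    the closure of the other factor; \<open>cl_UN_cl\<close> then inserts one around each
    product.\<close>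
  have "cl R (set_mult R A (cl R (\<Union>\<A>))) = cl R (\<Union>B\<in>\<A>. set_mult R A B)"
    using cl_set_mult_cl[OF sub] A set_mult_UN_right[of R A id \<A>] by (simp add: extentD(2))
  also have "\<dots> = cl R (\<Union>B\<in>\<A>. cl R (set_mult R A B))"
    by (intro cl_UN_cl[symmetric] set_mult_subset_lhs sub(1) subs)
  also have "\<dots> = \<Squnion>\<^bsub>concept_quantale R\<^esub>((\<lambda>B. cl R (set_mult R A B)) ` \<A>)"
    by (intro Sup_concept_quantale[symmetric] image_subsetI cl_extent)
  finally show "cl R (set_mult R A (\<Squnion>\<^bsub>concept_quantale R\<^esub>\<A>)) =
      \<Squnion>\<^bsub>concept_quantale R\<^esub>((\<lambda>B. cl R (set_mult R A B)) ` \<A>)"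
    by (simp only: Sup_concept_quantale[OF \<A>])
  have "cl R (set_mult R (cl R (\<Union>\<A>)) A) = cl R (\<Union>B\<in>\<A>. set_mult R B A)"
    using cl_set_mult_cl[OF sub(2,1)] A set_mult_UN_left[of R id \<A> A] by (simp add: extentD(2))
  also have "\<dots> = cl R (\<Union>B\<in>\<A>. cl R (set_mult R B A))"
    by (intro cl_UN_cl[symmetric] set_mult_subset_lhs sub(1) subs)
  also have "\<dots> = \<Squnion>\<^bsub>concept_quantale R\<^esub>((\<lambda>B. cl R (set_mult R B A)) ` \<A>)"
    by (intro Sup_concept_quantale[symmetric] image_subsetI cl_extent)
  finally show "cl R (set_mult R (\<Squnion>\<^bsub>concept_quantale R\<^esub>\<A>) A) =
      \<Squnion>\<^bsub>concept_quantale R\<^esub>((\<lambda>B. cl R (set_mult R B A)) ` \<A>)"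
    by (simp only: Sup_concept_quantale[OF \<A>])
qed (rule cl_extent)

section \<open>Bonds and homomorphisms of concept quantales\<close>

lemma bondsD:
  assumes "b \<in> bonds R S"
  shows "b \<subseteq> lhs R \<times> rhs S"
    and "x \<in> lhs R \<Longrightarrow> rup S (rdown S (row b x)) = row b x"
    and "w \<in> rhs S \<Longrightarrow> column b w \<in> extents R"
  using assms by (auto simp: bonds_def intents_def)

lemma row_bond_subset: "b \<in> bonds R S \<Longrightarrow> row b x \<subseteq> rhs S"
  using bondsD(1) by blast

text \<open>Each row of a bond is an intent, hence the \<open>S\<close>-polar of its own polar, and
  an intersection of polars is the polar of a union. Thus the induced map can be computed with the
  polars of \<open>S\<close> alone.\<close>

lemma up_bond_eq:
  assumes b: "b \<in> bonds R S" and A: "A \<subseteq> lhs R"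
  shows "up (lhs R) (rhs S) b A = rup S (\<Union>x\<in>A. rdown S (row b x))"
proof -
  have "up (lhs R) (rhs S) b A = rhs S \<inter> (\<Inter>x\<in>A. row b x)"
    by (auto simp: up_def)
  also have "\<dots> = rhs S \<inter> (\<Inter>x\<in>A. rup S (rdown S (row b x)))"
    using bondsD(2)[OF b] A by (simp add: subset_iff)
  also have "\<dots> = rup S (\<Union>x\<in>A. rdown S (row b x))"
    by (auto simp: up_def)
  finally show ?thesis .
qed

text \<open>Columns of a bond are extents, so a column containing \<open>A\<close> contains its
  closure.\<close>

lemma up_bond_cl:
  assumes b: "b \<in> bonds R S" and A: "A \<subseteq> lhs R"
  shows "up (lhs R) (rhs S) b (cl R A) = up (lhs R) (rhs S) b A"
proof
  show "up (lhs R) (rhs S) b (cl R A) \<subseteq> up (lhs R) (rhs S) b A"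
    using cl_extensive[OF A] by (auto simp: up_def)
  show "up (lhs R) (rhs S) b A \<subseteq> up (lhs R) (rhs S) b (cl R A)"
  proof
    fix w assume w: "w \<in> up (lhs R) (rhs S) b A"
    then have "cl R A \<subseteq> column b w"
      by (intro cl_least bondsD(3)[OF b]) (auto simp: up_def)
    then show "w \<in> up (lhs R) (rhs S) b (cl R A)"
      using w by (auto simp: up_def)
  qed
qed

text \<open>The right-hand side is a supremum in the concept quantale of \<open>S\<close>, namely of
  the polars of the rows over \<open>A\<close>. This form makes the induced map accessible to
  \<open>cl_UN_cl\<close>.\<close>

lemma bond_map_cl:
  assumes "b \<in> bonds R S" "A \<subseteq> lhs R"
  shows "bond_map R S b (cl R A) = cl S (\<Union>x\<in>A. rdown S (row b x))"
  using assms by (simp add: bond_map_def cl_extent up_bond_cl up_bond_eq cl_def[of S])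

lemma bond_map_cl_singleton:
  assumes "b \<in> bonds R S" "x \<in> lhs R"
  shows "bond_map R S b (cl R {x}) = rdown S (row b x)"
  using bond_map_cl[of b R S "{x}"] assms row_bond_subset[OF assms(1)]
  by (simp add: extentD rdown_extent)

text \<open>By \<open>bond_map_cl\<close> every value is a supremum of extents \<open>?d x\<close>.
  Preservation of suprema is then a rearrangement of unions, and preservation of products reduces to
  pairs of points, where it is the multiplicativity of the bond.\<close>

lemma bond_map_in_quantale_hom:
  assumes "residuated_relation R" "residuated_relation S" and b: "b \<in> mult_bonds R S"
  shows "bond_map R S b \<in> quantale_hom (concept_quantale R) (concept_quantale S)"
proof -
  interpret R: residuated_relation R by fact
  interpret S: residuated_relation S by fact
  have bond: "b \<in> bonds R S"
    using b by (simp add: mult_bonds_def)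
  let ?d = "\<lambda>x. rdown S (row b x)"
  have d_lhs: "?d x \<subseteq> lhs S" for x
    by (auto simp: down_def)
  have d_mult: "?d (smult R x x') = cl S (set_mult S (?d x) (?d x'))"
    if "x \<in> lhs R" "x' \<in> lhs R" for x x'
    using b that by (simp add: mult_bonds_def intent_mult_def cl_def)
  have ext: "bond_map R S b A = cl S (\<Union>x\<in>A. ?d x)" if "A \<in> extents R" for A
    using bond_map_cl[OF bond, of A] that by (simp add: extentD)
  have Sup: "bond_map R S b (\<Squnion>\<^bsub>concept_quantale R\<^esub>\<A>) =
      \<Squnion>\<^bsub>concept_quantale S\<^esub>(bond_map R S b ` \<A>)" if \<A>: "\<A> \<subseteq> extents R" for \<A>
  proof -
    have "\<Union>\<A> \<subseteq> lhs R"
      using \<A> extentD(1) by blast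
    then have "bond_map R S b (\<Squnion>\<^bsub>concept_quantale R\<^esub>\<A>) = cl S (\<Union>A\<in>\<A>. \<Union>x\<in>A. ?d x)"
      by (simp add: Sup_concept_quantale[OF \<A>] bond_map_cl[OF bond])
    also have "\<dots> = cl S (\<Union>A\<in>\<A>. cl S (\<Union>x\<in>A. ?d x))"
      by (intro cl_UN_cl[symmetric] UN_least d_lhs)
    also have "\<dots> = cl S (\<Union>(bond_map R S b ` \<A>))"
      using \<A> ext by (intro arg_cong[where f = "cl S"] SUP_cong) auto
    also have "\<dots> = \<Squnion>\<^bsub>concept_quantale S\<^esub>(bond_map R S b ` \<A>)"
      using \<A> ext by (intro Sup_concept_quantale[symmetric]) (auto simp: cl_extent)
    finally show ?thesis .
  qed
  have mult: "bond_map R S b (cl R (set_mult R A B)) =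
      cl S (set_mult S (bond_map R S b A) (bond_map R S b B))"
    if AB: "A \<in> extents R" "B \<in> extents R" for A B
  proof -
    have sub: "A \<subseteq> lhs R" "B \<subseteq> lhs R"
      using AB by (simp_all add: extentD)
    have set_mult_UN: "set_mult S (\<Union>x\<in>A. ?d x) (\<Union>x\<in>B. ?d x) =
        (\<Union>(x, x')\<in>A \<times> B. set_mult S (?d x) (?d x'))"
      unfolding set_mult_def by blast
    \<comment> \<open>Products are indexed by pairs, so that a single application of
      \<open>cl_UN_cl\<close> removes the closures around all the
      \<open>set_mult S (?d x) (?d x')\<close>.\<close>
    have "set_mult R A B = (\<lambda>p. smult R (fst p) (snd p)) ` (A \<times> B)"
      by (force simp: set_mult_def)
    then have "(\<Union>z\<in>set_mult R A B. ?d z) = (\<Union>p\<in>A \<times> B. ?d (smult R (fst p) (snd p)))"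
      by simp
    also have "\<dots> = (\<Union>p\<in>A \<times> B. cl S (set_mult S (?d (fst p)) (?d (snd p))))"
      using sub by (intro SUP_cong refl d_mult) auto
    finally have "bond_map R S b (cl R (set_mult R A B)) =
        cl S (\<Union>p\<in>A \<times> B. cl S (set_mult S (?d (fst p)) (?d (snd p))))"
      using bond_map_cl[OF bond R.set_mult_subset_lhs[OF sub]] by simp
    also have "\<dots> = cl S (\<Union>p\<in>A \<times> B. set_mult S (?d (fst p)) (?d (snd p)))"
      by (intro cl_UN_cl S.set_mult_subset_lhs d_lhs)
    also have "\<dots> = cl S (set_mult S (\<Union>x\<in>A. ?d x) (\<Union>x\<in>B. ?d x))"
      by (simp add: set_mult_UN case_prod_unfold)
    also have "\<dots> = cl S (set_mult S (cl S (\<Union>x\<in>A. ?d x)) (cl S (\<Union>x\<in>B. ?d x)))"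
      by (intro S.cl_set_mult_cl[symmetric] UN_least d_lhs)
    finally show ?thesis
      using AB by (simp add: ext)
  qed
  have "bond_map R S b \<in> extents R \<rightarrow>\<^sub>E extents S"
    using ext by (auto simp: bond_map_def cl_extent)
  then show ?thesis
    using Sup mult unfolding quantale_hom_def concept_quantale_simps by blast
qed

text \<open>The inverse of \<open>bond_map\<close>. Values of \<open>h\<close> are extents of
  \<open>S\<close> while rows of a bond must be intents, so a polar is taken.\<close>

definition bond_of_hom ::
    "('x, 'y) srel \<Rightarrow> ('z, 'w) srel \<Rightarrow> ('x set \<Rightarrow> 'z set) \<Rightarrow> ('x \<times> 'w) set" where
  "bond_of_hom R S h = {(x, w). x \<in> lhs R \<and> w \<in> rup S (h (cl R {x}))}"

lemma row_bond_of_hom: "x \<in> lhs R \<Longrightarrow> row (bond_of_hom R S h) x = rup S (h (cl R {x}))"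
  by (simp add: bond_of_hom_def)

text \<open>Rows are intents, so the polar of the polar of a row is that row again.\<close>

lemma bond_of_hom_bond_map:
  assumes b: "b \<in> bonds R S"
  shows "bond_of_hom R S (bond_map R S b) = b"
proof -
  have "x \<in> lhs R \<and> w \<in> rup S (bond_map R S b (cl R {x})) \<longleftrightarrow> (x, w) \<in> b" for x w
    using bond_map_cl_singleton[OF b, of x] bondsD(1)[OF b] bondsD(2)[OF b, of x] by auto
  then show ?thesis
    by (auto simp: bond_of_hom_def)
qed

section \<open>From quantale homomorphisms back to multiplicative bonds\<close>

context
  fixes R :: "('x, 'y) srel" and S :: "('z, 'w) srel" and h
  assumes R: "residuated_relation R" and S: "residuated_relation S"
    and h: "h \<in> quantale_hom (concept_quantale R) (concept_quantale S)"
begin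

interpretation R: residuated_relation R by (rule R)
interpretation S: residuated_relation S by (rule S)

lemma hom_extent: "A \<in> extents R \<Longrightarrow> h A \<in> extents S"
  using quantale_homD(1)[OF h] by (simp add: concept_quantale_simps)

lemma hom_mult:
  "\<lbrakk>A \<in> extents R; B \<in> extents R\<rbrakk> \<Longrightarrow> h (cl R (set_mult R A B)) = cl S (set_mult S (h A) (h B))"
  using quantale_homD(3)[OF h] by (simp add: concept_quantale_simps)

text \<open>Singleton closures are join-dense and \<open>h\<close> preserves suprema, so
  \<open>h\<close> is determined by its values on them.\<close>

lemma hom_cl:
  assumes A: "A \<subseteq> lhs R"
  shows "h (cl R A) = cl S (\<Union>x\<in>A. h (cl R {x}))"
proof -
  have "h (cl R A) = h (cl R (\<Union>((\<lambda>x. cl R {x}) ` A)))"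
    using UN_cl_singletons[OF A] by simp
  also have "\<dots> = h (\<Squnion>\<^bsub>concept_quantale R\<^esub>((\<lambda>x. cl R {x}) ` A))"
    by (subst Sup_concept_quantale) (auto simp: cl_extent)
  also have "\<dots> = \<Squnion>\<^bsub>concept_quantale S\<^esub>(h ` (\<lambda>x. cl R {x}) ` A)"
    by (rule quantale_homD(2)[OF h]) (auto simp: concept_quantale_simps cl_extent)
  also have "\<dots> = cl S (\<Union>(h ` (\<lambda>x. cl R {x}) ` A))"
    by (rule Sup_concept_quantale) (auto intro!: hom_extent cl_extent)
  finally show ?thesis
    by (simp add: image_image)
qed

text \<open>Rows are polars, hence intents. A column collects the points whose singleton closure
  \<open>h\<close> sends below a fixed extent; since \<open>h\<close> preserves suprema, it also
  sends the closure of the column below that extent, so the column is closed.\<close>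

lemma bond_of_hom_in_bonds: "bond_of_hom R S h \<in> bonds R S"
proof -
  have "rup S (h (cl R {x})) \<in> intents S" for x
    using extentD[OF hom_extent[OF cl_extent[of R "{x}"]]]
    by (auto simp: intents_def cl_def up_def)
  moreover have "column (bond_of_hom R S h) w \<in> extents R" if w: "w \<in> rhs S" for w
  proof -
    let ?A = "column (bond_of_hom R S h) w" and ?E = "rdown S {w}"
    have E: "?E \<in> extents S"
      using w by (intro rdown_extent) simp
    have A_iff: "x \<in> ?A \<longleftrightarrow> x \<in> lhs R \<and> h (cl R {x}) \<subseteq> ?E" for x
      using w extentD(1)[OF hom_extent[OF cl_extent[of R "{x}"]]]
      by (auto simp: bond_of_hom_def up_def down_def)
    then have A: "?A \<subseteq> lhs R"
      by blast
    have "h (cl R ?A) \<subseteq> ?E"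
      unfolding hom_cl[OF A] using A_iff by (intro cl_least[OF _ E] UN_least) blast
    \<comment> \<open>By monotonicity every point of the closure satisfies the condition that
      defines the column.\<close>
    moreover have "h (cl R {x}) \<subseteq> h (cl R ?A)" if "x \<in> cl R ?A" for x
      using quantale_hom_mono[OF R.quantale_concept_quantale S.quantale_concept_quantale h,
          of "cl R {x}" "cl R ?A"] cl_least[of "{x}" "cl R ?A" R] that
      by (simp add: concept_quantale_simps cl_extent)
    ultimately have "cl R ?A \<subseteq> ?A"
      using A_iff cl_subset_lhs[of R ?A] by blast
    then have "?A = cl R ?A"
      using cl_extensive[OF A] by blast
    then show ?thesis
      using cl_extent[of R ?A] by simp
  qed
  moreover have "bond_of_hom R S h \<subseteq> lhs R \<times> rhs S"
    by (auto simp: bond_of_hom_def up_def)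
  ultimately show ?thesis
    by (simp add: bonds_def row_bond_of_hom)
qed

lemma rdown_row_bond_of_hom: "x \<in> lhs R \<Longrightarrow> rdown S (row (bond_of_hom R S h) x) = h (cl R {x})"
  using extentD(2)[OF hom_extent[OF cl_extent[of R "{x}"]]] by (simp add: row_bond_of_hom cl_def)

text \<open>A product of singletons is a singleton, so \<open>cl R {smult R x x'}\<close> is the
  product of the two singleton closures in the concept quantale, and \<open>h\<close> preserves
  it.\<close>

lemma bond_of_hom_in_mult_bonds: "bond_of_hom R S h \<in> mult_bonds R S"
proof -
  have "rup S (h (cl R {smult R x x'})) = rup S (set_mult S (h (cl R {x})) (h (cl R {x'})))"
    if x: "x \<in> lhs R" "x' \<in> lhs R" for x x'
  proof -
    have "set_mult R {x} {x'} = {smult R x x'}"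
      by (auto simp: set_mult_def)
    then have "h (cl R {smult R x x'}) = h (cl R (set_mult R (cl R {x}) (cl R {x'})))"
      using R.cl_set_mult_cl[of "{x}" "{x'}"] x by simp
    also have "\<dots> = cl S (set_mult S (h (cl R {x})) (h (cl R {x'})))"
      by (intro hom_mult cl_extent)
    finally show ?thesis
      by (simp add: up_cl S.set_mult_subset_lhs extentD(1) hom_extent cl_extent)
  qed
  then show ?thesis
    using bond_of_hom_in_bonds R.smult_closed
    by (simp add: mult_bonds_def intent_mult_def rdown_row_bond_of_hom) (simp add: row_bond_of_hom)
qed

text \<open>By \<open>bond_map_cl\<close> and \<open>hom_cl\<close> both sides are the same supremum
  over the points of an extent; off the extents both take the default value.\<close>

lemma bond_map_bond_of_hom: "bond_map R S (bond_of_hom R S h) = h"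
proof (rule extensionalityI)
  show "bond_map R S (bond_of_hom R S h) \<in> extensional (extents R)"
    by (simp add: bond_map_def)
  show "h \<in> extensional (extents R)"
    using quantale_homD(4)[OF h] by (simp add: concept_quantale_simps)
  fix A assume A: "A \<in> extents R"
  have sub: "A \<subseteq> lhs R"
    using A by (rule extentD(1))
  then have "(\<Union>x\<in>A. rdown S (row (bond_of_hom R S h) x)) = (\<Union>x\<in>A. h (cl R {x}))"
    by (intro SUP_cong refl rdown_row_bond_of_hom) (rule subsetD)
  then have "bond_map R S (bond_of_hom R S h) (cl R A) = h (cl R A)"
    by (simp only: bond_map_cl[OF bond_of_hom_in_bonds sub] hom_cl[OF sub])
  then show "bond_map R S (bond_of_hom R S h) A = h A"
    using A by (simp add: extentD)
qed

end

lemma bond_map_bij: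
  assumes "residuated_relation R" "residuated_relation S"
  shows "bij_betw (bond_map R S) (mult_bonds R S)
    (quantale_hom (concept_quantale R) (concept_quantale S))"
proof (rule bij_betw_byWitness[where f' = "bond_of_hom R S"])
  show "\<forall>b \<in> mult_bonds R S. bond_of_hom R S (bond_map R S b) = b"
    by (simp add: mult_bonds_def bond_of_hom_bond_map)
qed (use assms bond_map_bond_of_hom bond_map_in_quantale_hom bond_of_hom_in_mult_bonds in blast)+

text \<open>Bond composition is composition of maps transported along \<open>bond_map\<close>; this
  is what lets the category laws be read off in \<open>Quant\<close>.\<close>

lemma bond_comp_eq:
  assumes b: "b \<in> bonds R S" and c: "c \<in> bonds S T"
  shows "bond_comp R S T c b = bond_of_hom R T (compose (extents R) (bond_map S T c) (bond_map R S b))"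
proof -
  have "rup T (bond_map S T c (bond_map R S b (cl R {x}))) =
      {v \<in> rhs T. rdown S (row b x) \<subseteq> column c v}" if x: "x \<in> lhs R" for x
  proof -
    let ?d = "rdown S (row b x)"
    have d: "?d \<in> extents S"
      by (intro rdown_extent row_bond_subset[OF b])
    have "rup T (bond_map S T c ?d) = rup T (rdown T (up (lhs S) (rhs T) c ?d))"
      using d by (simp add: bond_map_def)
    \<comment> \<open>By \<open>up_bond_eq\<close> this set is a \<open>T\<close>-polar, hence
      unchanged by passing to the extent and back.\<close>
    also have "\<dots> = up (lhs S) (rhs T) c ?d"
      unfolding up_bond_eq[OF c extentD(1)[OF d]] by (auto simp: up_def down_def)
    finally show ?thesis
      unfolding bond_map_cl_singleton[OF b x] by (auto simp: up_def)
  qed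
  then show ?thesis
    by (auto simp: bond_comp_def bond_of_hom_def compose_def cl_extent)
qed

text \<open>A point and its closure have the same polar, so the identity homomorphism gives back the
  relation.\<close>

lemma (in residuated_relation) rel_eq_bond_of_hom:
  "rel R = bond_of_hom R R (\<lambda>A \<in> extents R. A)"
proof -
  have "rup R (cl R {x}) = {y. (x, y) \<in> rel R}" if "x \<in> lhs R" for x
    using that rel_subset up_cl[of "{x}" R] by (auto simp: up_def)
  then show ?thesis
    using rel_subset by (auto simp: bond_of_hom_def cl_extent)
qed

section \<open>The concept quantale functor\<close>

lemma quantale_hom_id:
  assumes "quantale Q"
  shows "(\<lambda>x \<in> carrier Q. x) \<in> quantale_hom Q Q"
proof -
  interpret quantale Q by fact
  have "restrict (\<lambda>x. x) (carrier Q) ` A = A" if "A \<subseteq> carrier Q" for A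
    using that by (auto simp: subset_iff image_iff)
  then show ?thesis
    using qtimes_closed by (auto simp: quantale_hom_def)
qed

lemma quantale_hom_compose:
  assumes "quantale P" "quantale Q" and f: "f \<in> quantale_hom P Q" and g: "g \<in> quantale_hom Q S"
  shows "compose (carrier P) g f \<in> quantale_hom P S"
proof -
  interpret P: quantale P by fact
  interpret Q: quantale Q by fact
  note f = quantale_homD[OF f] and g = quantale_homD[OF g]
  have "compose (carrier P) g f (\<Squnion>\<^bsub>P\<^esub>A) = \<Squnion>\<^bsub>S\<^esub>(compose (carrier P) g f ` A)"
    if A: "A \<subseteq> carrier P" for A
  proof -
    have "compose (carrier P) g f ` A = g ` f ` A"
      using A by (auto simp: compose_def image_iff subset_iff)
    moreover have "f ` A \<subseteq> carrier Q"
      using A f(1) by blast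
    ultimately show ?thesis
      using A f(2) g(2) by (simp add: compose_def)
  qed
  then show ?thesis
    using f(1,3) g(1,3) P.qtimes_closed by (auto simp: quantale_hom_def compose_def)
qed

lemma category_Quant: "category (Quant \<U> :: ('a quant, 'a \<Rightarrow> 'a) cat)"
proof -
  have hom: "f \<in> carrier P \<rightarrow> carrier Q" "f \<in> extensional (carrier P)"
    if "f \<in> quantale_hom P Q" for P Q :: "'a quant" and f
    using quantale_homD(1,4)[OF that] by auto
  show ?thesis
  proof (unfold_locales, unfold Quant_def cat.simps mem_Collect_eq)
    show "compose (carrier a) f (\<lambda>x \<in> carrier a. x) = f" if "f \<in> quantale_hom a b" for a b :: "'a quant" and f
      using hom[OF that] by (rule compose_Id)
    show "compose (carrier a) (\<lambda>x \<in> carrier b. x) f = f" if "f \<in> quantale_hom a b" for a b :: "'a quant" and f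
      using hom[OF that] by (rule Id_compose)
    show "compose (carrier a) h (compose (carrier a) g f) = compose (carrier a) (compose (carrier b) h g) f"
      if "f \<in> quantale_hom a b" for a b :: "'a quant" and f g h
      using hom(1)[OF that] by (rule compose_assoc)
  qed (auto intro: quantale_hom_id quantale_hom_compose)
qed

text \<open>The composite is \<open>bond_of_hom\<close> of a composite homomorphism, so both claims
  follow from the correspondence between bonds and homomorphisms.\<close>

lemma bond_comp_in_mult_bonds:
  assumes "residuated_relation R" "residuated_relation S" "residuated_relation T"
    and b: "b \<in> mult_bonds R S" and c: "c \<in> mult_bonds S T"
  shows "bond_comp R S T c b \<in> mult_bonds R T"
    and "bond_map R T (bond_comp R S T c b) = compose (extents R) (bond_map S T c) (bond_map R S b)"
proof -
  have comp: "compose (extents R) (bond_map S T c) (bond_map R S b)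
      \<in> quantale_hom (concept_quantale R) (concept_quantale T)"
    using quantale_hom_compose[OF _ _ bond_map_in_quantale_hom[OF _ _ b] bond_map_in_quantale_hom[OF _ _ c]]
      assms(1-3) by (simp add: residuated_relation.quantale_concept_quantale concept_quantale_simps)
  have eq: "bond_comp R S T c b =
      bond_of_hom R T (compose (extents R) (bond_map S T c) (bond_map R S b))"
    using b c by (intro bond_comp_eq) (auto simp: mult_bonds_def)
  show "bond_comp R S T c b \<in> mult_bonds R T"
    "bond_map R T (bond_comp R S T c b) = compose (extents R) (bond_map S T c) (bond_map R S b)"
    unfolding eq using assms(1,3) comp by (simp_all add: bond_of_hom_in_mult_bonds bond_map_bond_of_hom)
qed

text \<open>The identity bond is handled in the same way, through the identity homomorphism.\<close>

lemma (in residuated_relation) rel_in_mult_bonds: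
  shows "rel R \<in> mult_bonds R R" and "bond_map R R (rel R) = (\<lambda>A \<in> extents R. A)"
proof -
  have "(\<lambda>A \<in> extents R. A) \<in> quantale_hom (concept_quantale R) (concept_quantale R)"
    using quantale_hom_id[OF quantale_concept_quantale] by (simp add: concept_quantale_simps)
  then show "rel R \<in> mult_bonds R R" "bond_map R R (rel R) = (\<lambda>A \<in> extents R. A)"
    using residuated_relation_axioms unfolding rel_eq_bond_of_hom
    by (simp_all add: bond_of_hom_in_mult_bonds bond_map_bond_of_hom)
qed

lemma concept_functor_bij:
  assumes "R \<in> Obj (ResRel \<U>)" "S \<in> Obj (ResRel \<U>)"
  shows "bij_betw (arr_map concept_functor R S) (Hom (ResRel \<U>) R S)
    (Hom (Quant \<U>) (obj_map concept_functor R) (obj_map concept_functor S))"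
  using assms bond_map_bij[of R S] by (simp add: ResRel_def Quant_def concept_functor_def)

lemma bond_map_funcset:
  assumes "residuated_relation R" "residuated_relation S" "b \<in> mult_bonds R S"
  shows "bond_map R S b \<in> extents R \<rightarrow> extents S" "bond_map R S b \<in> extensional (extents R)"
  using quantale_homD(1,4)[OF bond_map_in_quantale_hom[OF assms]]
  by (auto simp: concept_quantale_simps)

lemma bond_map_inject:
  assumes "bond_map R S b = bond_map R S c" "b \<in> mult_bonds R S" "c \<in> mult_bonds R S"
  shows "b = c"
proof -
  have "b \<in> bonds R S" "c \<in> bonds R S"
    using assms(2,3) by (simp_all add: mult_bonds_def)
  then show ?thesis
    using bond_of_hom_bond_map assms(1) by metis
qed

text \<open>The laws of \<open>ResRel\<close> are reflected from \<open>Quant\<close> along the injective arrow maps.\<close>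

lemma category_ResRel: "category (ResRel \<U>)"
proof (unfold_locales, unfold ResRel_def cat.simps mem_Collect_eq, goal_cases)
  case (1 R)
  then show ?case
    by (intro residuated_relation.rel_in_mult_bonds) blast
next
  case (2 R S T b c)
  then show ?case
    by (intro bond_comp_in_mult_bonds) blast+
next
  case (3 R S b)
  then have R: "residuated_relation R" and S: "residuated_relation S" and b: "b \<in> mult_bonds R S"
    by blast+
  note id = residuated_relation.rel_in_mult_bonds[OF R]
  show ?case
    by (rule bond_map_inject[OF _ bond_comp_in_mult_bonds(1)[OF R R S id(1) b] b])
      (simp only: bond_comp_in_mult_bonds(2)[OF R R S id(1) b] id(2)
        compose_Id[OF bond_map_funcset[OF R S b]])
next
  case (4 R S b)
  then have R: "residuated_relation R" and S: "residuated_relation S" and b: "b \<in> mult_bonds R S"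
    by blast+
  note id = residuated_relation.rel_in_mult_bonds[OF S]
  show ?case
    by (rule bond_map_inject[OF _ bond_comp_in_mult_bonds(1)[OF R S S b id(1)] b])
      (simp only: bond_comp_in_mult_bonds(2)[OF R S S b id(1)] id(2)
        Id_compose[OF bond_map_funcset[OF R S b]])
next
  case (5 R S T U b c d)
  then have R: "residuated_relation R" and S: "residuated_relation S"
    and T: "residuated_relation T" and U: "residuated_relation U"
    and b: "b \<in> mult_bonds R S" and c: "c \<in> mult_bonds S T" and d: "d \<in> mult_bonds T U"
    by blast+
  note bc = bond_comp_in_mult_bonds[OF R S T b c] and cd = bond_comp_in_mult_bonds[OF S T U c d]
  note bcd = bond_comp_in_mult_bonds[OF R T U bc(1) d] bond_comp_in_mult_bonds[OF R S U b cd(1)]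
  show ?case
    by (rule bond_map_inject[OF _ bcd(1) bcd(3)])
      (simp only: bcd(2,4) bc(2) cd(2) compose_assoc[OF bond_map_funcset(1)[OF R S b]])
qed

lemma cat_functor_concept_functor: "cat_functor (ResRel \<U>) (Quant \<U>) concept_functor"
proof (intro cat_functor.intro category_ResRel category_Quant cat_functor_axioms.intro,
    unfold ResRel_def Quant_def concept_functor_def cat.simps fun_data.simps mem_Collect_eq)
qed (blast intro: residuated_relation.quantale_concept_quantale bond_map_in_quantale_hom
      bond_comp_in_mult_bonds(2)
    | simp add: concept_quantale_simps residuated_relation.quantale_concept_quantale
      residuated_relation.rel_in_mult_bonds bond_comp_in_mult_bonds(2))+

section \<open>Every quantale is a concept quantale\<close>

text \<open>In the application \<open>Q\<close> lives on a type of sets while \<open>ResRel\<close>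
  has elements of type \<open>'u\<close>, so order and product are moved along \<open>f\<close>. For
  \<open>f\<close> injective on the carrier, \<open>the_inv_into\<close> recovers the
  factors.\<close>

definition order_srel :: "'a quant \<Rightarrow> ('a \<Rightarrow> 'u) \<Rightarrow> ('u, 'u) srel" where
  "order_srel Q f = \<lparr>
     lhs = f ` carrier Q,
     smult = (\<lambda>u v. f (the_inv_into (carrier Q) f u \<cdot>\<^bsub>Q\<^esub> the_inv_into (carrier Q) f v)),
     rhs = f ` carrier Q,
     rel = {(f x, f y) | x y. x \<in> carrier Q \<and> y \<in> carrier Q \<and> x \<sqsubseteq>\<^bsub>Q\<^esub> y}\<rparr>"

text \<open>The map that becomes the isomorphism from \<open>Q\<close> onto the concept quantale of
  \<open>order_srel Q f\<close>.\<close>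

definition lower_image :: "'a quant \<Rightarrow> ('a \<Rightarrow> 'u) \<Rightarrow> 'a \<Rightarrow> 'u set" where
  "lower_image Q f q = f ` {x \<in> carrier Q. x \<sqsubseteq>\<^bsub>Q\<^esub> q}"

section \<open>Residuals of a quantale\<close>

context quantale
begin

lemma le_sup_iff:
  assumes "A \<subseteq> carrier Q" "z \<in> carrier Q"
  shows "\<Squnion>A \<sqsubseteq> z \<longleftrightarrow> (\<forall>a\<in>A. a \<sqsubseteq> z)"
proof
  assume le: "\<Squnion>A \<sqsubseteq> z"
  show "\<forall>a\<in>A. a \<sqsubseteq> z"
  proof
    fix a assume a: "a \<in> A"
    then have "a \<sqsubseteq> \<Squnion>A"
      using assms(1) by (intro sup_upper)
    then show "a \<sqsubseteq> z"
      using le by (rule le_trans) (use assms a in auto)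
  qed
next
  assume "\<forall>a\<in>A. a \<sqsubseteq> z"
  then show "\<Squnion>A \<sqsubseteq> z"
    using assms by (intro sup_least) (auto simp: Upper_def)
qed

text \<open>Multiplication by \<open>x\<close> on the right preserves suprema, so the supremum of
  all \<open>w\<close> with \<open>w\<close> times \<open>x\<close> below \<open>y\<close> itself
  satisfies this inequality: it is the largest such element.\<close>

lemma residual_left:
  assumes x: "x \<in> carrier Q" and y: "y \<in> carrier Q" and z: "z \<in> carrier Q"
  shows "z \<sqsubseteq> \<Squnion>{w \<in> carrier Q. w \<cdot> x \<sqsubseteq> y} \<longleftrightarrow> z \<cdot> x \<sqsubseteq> y"
proof
  let ?W = "{w \<in> carrier Q. w \<cdot> x \<sqsubseteq> y}"
  have W: "?W \<subseteq> carrier Q"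
    by blast
  assume "z \<sqsubseteq> \<Squnion>?W"
  then have "z \<cdot> x \<sqsubseteq> \<Squnion>?W \<cdot> x"
    by (rule qtimes_mono) (simp_all add: x z W)
  moreover have "\<Squnion>?W \<cdot> x \<sqsubseteq> y"
    unfolding qtimes_Sup_left[OF x W] by (subst le_sup_iff) (auto simp: qtimes_closed x y)
  ultimately show "z \<cdot> x \<sqsubseteq> y"
    by (rule le_trans) (simp_all add: qtimes_closed x y z W)
next
  assume "z \<cdot> x \<sqsubseteq> y"
  then show "z \<sqsubseteq> \<Squnion>{w \<in> carrier Q. w \<cdot> x \<sqsubseteq> y}"
    using z by (intro sup_upper) auto
qed

lemma residual_right:
  assumes x: "x \<in> carrier Q" and y: "y \<in> carrier Q" and z: "z \<in> carrier Q"
  shows "z \<sqsubseteq> \<Squnion>{w \<in> carrier Q. x \<cdot> w \<sqsubseteq> y} \<longleftrightarrow> x \<cdot> z \<sqsubseteq> y"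
proof
  let ?W = "{w \<in> carrier Q. x \<cdot> w \<sqsubseteq> y}"
  have W: "?W \<subseteq> carrier Q"
    by blast
  assume "z \<sqsubseteq> \<Squnion>?W"
  then have "x \<cdot> z \<sqsubseteq> x \<cdot> \<Squnion>?W"
    by (intro qtimes_mono) (simp_all add: x z W)
  moreover have "x \<cdot> \<Squnion>?W \<sqsubseteq> y"
    unfolding qtimes_Sup_right[OF x W] by (subst le_sup_iff) (auto simp: qtimes_closed x y)
  ultimately show "x \<cdot> z \<sqsubseteq> y"
    by (rule le_trans) (simp_all add: qtimes_closed x y z W)
next
  assume "x \<cdot> z \<sqsubseteq> y"
  then show "z \<sqsubseteq> \<Squnion>{w \<in> carrier Q. x \<cdot> w \<sqsubseteq> y}"
    using z by (intro sup_upper) auto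
qed

section \<open>The order relation of a quantale and its extents\<close>

context
  fixes f :: "'a \<Rightarrow> 'u"
  assumes inj: "inj_on f (carrier Q)"
begin

lemma order_srel_simps:
  "lhs (order_srel Q f) = f ` carrier Q"
  "rhs (order_srel Q f) = f ` carrier Q"
  "\<lbrakk>x \<in> carrier Q; y \<in> carrier Q\<rbrakk> \<Longrightarrow> smult (order_srel Q f) (f x) (f y) = f (x \<cdot> y)"
  "\<lbrakk>x \<in> carrier Q; y \<in> carrier Q\<rbrakk> \<Longrightarrow> (f x, f y) \<in> rel (order_srel Q f) \<longleftrightarrow> x \<sqsubseteq> y"
  by (auto simp: order_srel_def the_inv_into_f_f[OF inj] inj_on_eq_iff[OF inj])

lemma residuated_order_srel: "residuated_relation (order_srel Q f)"
proof
  let ?g = "the_inv_into (carrier Q) f"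
  note simps = order_srel_simps the_inv_into_f_f[OF inj] qtimes_closed residual_left residual_right
  show "rel (order_srel Q f) \<subseteq> lhs (order_srel Q f) \<times> rhs (order_srel Q f)"
    by (auto simp: order_srel_def)
  show "\<exists>swl swr.
      (\<forall>x \<in> lhs (order_srel Q f). \<forall>y \<in> rhs (order_srel Q f).
        swl y x \<in> rhs (order_srel Q f) \<and> swr x y \<in> rhs (order_srel Q f)) \<and>
      (\<forall>x \<in> lhs (order_srel Q f). \<forall>x' \<in> lhs (order_srel Q f). \<forall>y \<in> rhs (order_srel Q f).
        ((smult (order_srel Q f) x x', y) \<in> rel (order_srel Q f) \<longleftrightarrow>
          (x, swl y x') \<in> rel (order_srel Q f)) \<and>
        ((smult (order_srel Q f) x x', y) \<in> rel (order_srel Q f) \<longleftrightarrow>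
          (x', swr x y) \<in> rel (order_srel Q f)))"
    \<comment> \<open>The residuals of \<open>Q\<close>, computed after pulling the arguments back
      along \<open>f\<close> and carried forward again.\<close>
    by (intro exI[of _ "\<lambda>y x. f (\<Squnion>{w \<in> carrier Q. w \<cdot> ?g x \<sqsubseteq> ?g y})"]
        exI[of _ "\<lambda>x y. f (\<Squnion>{w \<in> carrier Q. ?g x \<cdot> w \<sqsubseteq> ?g y})"])
      (auto simp: simps)
qed (auto simp: order_srel_simps qtimes_closed qtimes_assoc)

lemma rup_order_srel: "A \<subseteq> carrier Q \<Longrightarrow> rup (order_srel Q f) (f ` A) = f ` Upper Q A"
  by (auto simp: up_def Upper_def order_srel_simps subset_iff)

lemma rdown_order_srel: "A \<subseteq> carrier Q \<Longrightarrow> rdown (order_srel Q f) (f ` A) = f ` Lower Q A"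
  by (auto simp: down_def Lower_def order_srel_simps subset_iff)

text \<open>Up to \<open>f\<close> the polars are \<open>Upper\<close> and \<open>Lower\<close>. By
  completeness the upper bounds of \<open>A\<close> are the elements above its supremum, so the
  elements below all of them form a principal down-set.\<close>

lemma cl_order_srel:
  assumes A: "A \<subseteq> carrier Q"
  shows "cl (order_srel Q f) (f ` A) = lower_image Q f (\<Squnion>A)"
proof -
  have "Lower Q (Upper Q A) = {x \<in> carrier Q. x \<sqsubseteq> \<Squnion>A}"
  proof (intro equalityI subsetI)
    fix x assume x: "x \<in> Lower Q (Upper Q A)"
    have "\<Squnion>A \<in> Upper Q A"
      using A by (intro Upper_memI sup_upper) auto
    then show "x \<in> {x \<in> carrier Q. x \<sqsubseteq> \<Squnion>A}"
      using x by (auto simp: Lower_def Upper_def)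
  next
    fix x assume x: "x \<in> {x \<in> carrier Q. x \<sqsubseteq> \<Squnion>A}"
    have "x \<sqsubseteq> u" if u: "u \<in> Upper Q A" for u
      by (rule le_trans[of x "\<Squnion>A"]) (use x u A in \<open>auto simp: Upper_def le_sup_iff\<close>)
    then show "x \<in> Lower Q (Upper Q A)"
      using x by (auto simp: Lower_def)
  qed
  then show ?thesis
    using rup_order_srel[OF A] rdown_order_srel[of "Upper Q A"] by (simp add: cl_def lower_image_def)
qed

lemma lower_image_eq_cl: "q \<in> carrier Q \<Longrightarrow> lower_image Q f q = cl (order_srel Q f) {f q}"
  using cl_order_srel[of "{q}"] by simp

lemma lower_image_subset_iff:
  assumes "p \<in> carrier Q" "q \<in> carrier Q"
  shows "lower_image Q f p \<subseteq> lower_image Q f q \<longleftrightarrow> p \<sqsubseteq> q"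
proof
  assume sub: "lower_image Q f p \<subseteq> lower_image Q f q"
  have "f p \<in> lower_image Q f p"
    using assms by (auto simp: lower_image_def)
  then have "f p \<in> lower_image Q f q"
    using sub by blast
  then show "p \<sqsubseteq> q"
    using assms by (auto simp: lower_image_def inj_on_eq_iff[OF inj])
next
  assume "p \<sqsubseteq> q"
  then have "x \<sqsubseteq> q" if "x \<in> carrier Q" "x \<sqsubseteq> p" for x
    using that assms by (auto intro: le_trans)
  then show "lower_image Q f p \<subseteq> lower_image Q f q"
    by (auto simp: lower_image_def)
qed

text \<open>Injectivity is antisymmetry of the order. For surjectivity, an extent is its own
  closure, hence by \<open>cl_order_srel\<close> a principal down-set.\<close>

lemma bij_lower_image: "bij_betw (lower_image Q f) (carrier Q) (extents (order_srel Q f))"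
proof (rule bij_betwI')
  show "lower_image Q f p = lower_image Q f q \<longleftrightarrow> p = q" if "p \<in> carrier Q" "q \<in> carrier Q" for p q
    using lower_image_subset_iff[OF that] lower_image_subset_iff[OF that(2,1)] le_antisym that by auto
  show "lower_image Q f q \<in> extents (order_srel Q f)" if "q \<in> carrier Q" for q
    by (simp add: lower_image_eq_cl that cl_extent)
  show "\<exists>q \<in> carrier Q. E = lower_image Q f q" if E: "E \<in> extents (order_srel Q f)" for E
  proof -
    have "E \<subseteq> f ` carrier Q"
      using extentD(1)[OF E] by (simp add: order_srel_simps)
    then obtain A where A: "A \<subseteq> carrier Q" "E = f ` A"
      by (auto simp: subset_image_iff)
    then have "E = lower_image Q f (\<Squnion>A)"
      using extentD(2)[OF E] cl_order_srel by simp
    then show ?thesis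
      using A(1) by (intro bexI[of _ "\<Squnion>A"]) simp_all
  qed
qed

text \<open>Principal down-sets are closures of singletons, so their product is the closure of a
  product of singletons.\<close>

lemma lower_image_qtimes:
  assumes "p \<in> carrier Q" "q \<in> carrier Q"
  shows "lower_image Q f (p \<cdot> q) =
    lower_image Q f p \<cdot>\<^bsub>concept_quantale (order_srel Q f)\<^esub> lower_image Q f q"
proof -
  interpret R: residuated_relation "order_srel Q f"
    by (rule residuated_order_srel)
  have "set_mult (order_srel Q f) {f p} {f q} = {f (p \<cdot> q)}"
    using assms by (auto simp: set_mult_def order_srel_simps)
  then show ?thesis
    using R.cl_set_mult_cl[of "{f p}" "{f q}"] assms
    by (simp add: lower_image_eq_cl concept_quantale_simps order_srel_simps qtimes_closed)
qed

end

end

text \<open>The arrow obtained is the inverse of \<open>f\<close>: the down-set map starts at the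
  given quantale, whereas essential surjectivity asks for an arrow ending there.\<close>

lemma iso_arrow_of_order_iso:
  fixes P Q :: "'a quant"
  assumes P: "P \<in> Obj (Quant \<U>)" and Q: "Q \<in> Obj (Quant \<U>)"
    and bij: "bij_betw f (carrier P) (carrier Q)"
    and le: "\<And>x y. \<lbrakk>x \<in> carrier P; y \<in> carrier P\<rbrakk> \<Longrightarrow> f x \<sqsubseteq>\<^bsub>Q\<^esub> f y \<longleftrightarrow> x \<sqsubseteq>\<^bsub>P\<^esub> y"
    and mult: "\<And>x y. \<lbrakk>x \<in> carrier P; y \<in> carrier P\<rbrakk> \<Longrightarrow> f (x \<cdot>\<^bsub>P\<^esub> y) = f x \<cdot>\<^bsub>Q\<^esub> f y"
  shows "\<exists>g. iso_arrow (Quant \<U>) Q P g"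
proof -
  interpret P: quantale P using P by (simp add: Quant_def)
  interpret Q: quantale Q using Q by (simp add: Quant_def)
  let ?g = "the_inv_into (carrier P) f"
  have gf: "?g (f x) = x" if "x \<in> carrier P" for x
    using bij that by (simp add: bij_betw_def the_inv_into_f_f)
  have fg: "?g y \<in> carrier P" "f (?g y) = y" if "y \<in> carrier Q" for y
    using bij that bij_betw_the_inv_into[OF bij]
    by (auto simp: f_the_inv_into_f_bij_betw bij_betw_def)
  have f_in: "f x \<in> carrier Q" if "x \<in> carrier P" for x
    using bij that by (auto simp: bij_betw_def)
  have "restrict f (carrier P) \<in> quantale_hom P Q"
    using P.quantale_axioms Q.quantale_axioms bij le mult by (rule quantale_hom_of_order_iso)
  moreover have "restrict ?g (carrier Q) \<in> quantale_hom Q P"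
  proof (rule quantale_hom_of_order_iso[OF Q.quantale_axioms P.quantale_axioms bij_betw_the_inv_into[OF bij]])
    show "?g x \<sqsubseteq>\<^bsub>P\<^esub> ?g y \<longleftrightarrow> x \<sqsubseteq>\<^bsub>Q\<^esub> y" if "x \<in> carrier Q" "y \<in> carrier Q" for x y
      using le[of "?g x" "?g y"] fg that by simp
    show "?g (x \<cdot>\<^bsub>Q\<^esub> y) = ?g x \<cdot>\<^bsub>P\<^esub> ?g y" if "x \<in> carrier Q" "y \<in> carrier Q" for x y
      using mult[of "?g x" "?g y"] gf[of "?g x \<cdot>\<^bsub>P\<^esub> ?g y"] fg that P.qtimes_closed by simp
  qed
  moreover have "compose (carrier Q) (restrict f (carrier P)) (restrict ?g (carrier Q)) = (\<lambda>x \<in> carrier Q. x)"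
    "compose (carrier P) (restrict ?g (carrier Q)) (restrict f (carrier P)) = (\<lambda>x \<in> carrier P. x)"
    by (auto simp: compose_def gf fg f_in intro!: restrict_ext)
  ultimately show ?thesis
    unfolding iso_arrow_def by (auto simp: Quant_def)
qed

lemma concept_functor_ess_surj:
  fixes Q :: "'u set quant" and \<U> :: "'u set set"
  assumes Q: "Q \<in> Obj (Quant \<U>)"
  shows "\<exists>R \<in> Obj (ResRel \<U> :: (('u, 'u) srel, ('u \<times> 'u) set) cat).
    \<exists>g. iso_arrow (Quant \<U>) (obj_map concept_functor R) Q g"
proof -
  interpret quantale Q using Q by (simp add: Quant_def)
  obtain B f where B: "B \<in> \<U>" and f: "bij_betw f (carrier Q) B"
    using Q by (auto simp: Quant_def small_def eqpoll_def)
  have inj: "inj_on f (carrier Q)" and img: "f ` carrier Q = B"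
    using f by (auto simp: bij_betw_def)
  let ?R = "order_srel Q f"
  \<comment> \<open>The extents are in bijection with the carrier of \<open>Q\<close>, so their
    smallness is inherited from \<open>Q\<close>.\<close>
  have "extents ?R \<approx> carrier Q"
    using bij_lower_image[OF inj] eqpoll_def eqpoll_sym by blast
  then have "small \<U> (extents ?R)"
    using Q eqpoll_trans by (fastforce simp: Quant_def small_def)
  moreover have "small \<U> B"
    using B by (auto simp: small_def)
  ultimately have R: "?R \<in> Obj (ResRel \<U>)"
    by (simp add: ResRel_def residuated_order_srel[OF inj] order_srel_simps(1,2)[OF inj] img)
  have "\<exists>g. iso_arrow (Quant \<U>) (concept_quantale ?R) Q g"
  proof (rule iso_arrow_of_order_iso[OF Q])
    show "concept_quantale ?R \<in> Obj (Quant \<U>)"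
      using R by (simp add: ResRel_def Quant_def concept_quantale_simps
          residuated_relation.quantale_concept_quantale)
    show "bij_betw (lower_image Q f) (carrier Q) (carrier (concept_quantale ?R))"
      using bij_lower_image[OF inj] by (simp add: concept_quantale_simps)
    show "lower_image Q f x \<sqsubseteq>\<^bsub>concept_quantale ?R\<^esub> lower_image Q f y \<longleftrightarrow> x \<sqsubseteq>\<^bsub>Q\<^esub> y"
      if "x \<in> carrier Q" "y \<in> carrier Q" for x y
      using lower_image_subset_iff[OF inj that] by (simp add: concept_quantale_simps)
  qed (rule lower_image_qtimes[OF inj])
  then show ?thesis
    using R by (intro bexI[of _ ?R]) (simp_all add: concept_functor_def)
qed

theorem theorem6p5:
  fixes \<U> :: "'u set set"
  shows "equivalence_of_categories
    (ResRel \<U> :: (('u, 'u) srel, ('u \<times> 'u) set) cat)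
    (Quant \<U> :: ('u set quant, 'u set \<Rightarrow> 'u set) cat)
    concept_functor"
  by (rule equivalence_of_categoriesI[OF cat_functor_concept_functor concept_functor_bij
        concept_functor_ess_surj])

end
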